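(* Let $\Phi:\{0,1\}^\omega\to\{0,1\}^\omega$ be a computable injection. If $X\in\{0,1\}^\omega$ is computably random (with respect to the uniform measure $\mu$), then $\Phi(X)$ is computably random with respect to the measure $\mu\circ\Phi^{-1}$, i.e. no computable $\Phi$-martingale succeeds on $\Phi(X)$.
   Context: $\mu$ is the uniform measure; $X$ is computably random if no computable martingale ($m(\sigma0)+m(\sigma1)=2m(\sigma)$, values uniformly computable reals) satisfies $\limsup_n m(X\upharpoonright n)=\infty$. A $\Phi$-martingale is a function $b:\{0,1\}^{<\omega}\to\mathbb{R}_{\ge0}$ with $b(\tau)\mu(\Phi^{-1}[\tau])=b(\tau0)\mu(\Phi^{-1}[\tau0])+b(\tau1)\mu(\Phi^{-1}[\tau1])$ for all $\tau$; it is computable if $b(\tau)$ is a computable real uniformly in $\tau$, and it succeeds on $Y$ if $\limsup_n b(Y\upharpoonright n)=\infty$. Computable randomness of $Y$ with respect to $\mu\circ\Phi^{-1}$ means no computable $\Phi$-martingale succeeds on $Y$. *)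

theory Defs
  imports "HOL-Probability.Probability" "HOL-Library.Sublist" "HOL-Library.Nat_Bijection"
begin

datatype recf =
    Zero
  | Succ
  | Proj nat
  | Comp recf "recf list"
  | Prec recf recf
  | Minz recf

inductive eval :: "recf \<Rightarrow> nat list \<Rightarrow> nat \<Rightarrow> bool" where
  eval_Zero: "eval Zero xs 0"
| eval_Succ: "eval Succ (x # xs) (Suc x)"
| eval_Proj: "i < length xs \<Longrightarrow> eval (Proj i) xs (xs ! i)"
| eval_Comp: "list_all2 (\<lambda>g y. eval g xs y) gs ys \<Longrightarrow> eval f ys z \<Longrightarrow> eval (Comp f gs) xs z"
| eval_Prec0: "eval f xs y \<Longrightarrow> eval (Prec f g) (0 # xs) y"
| eval_PrecS: "eval (Prec f g) (n # xs) z \<Longrightarrow> eval g (n # z # xs) y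
               \<Longrightarrow> eval (Prec f g) (Suc n # xs) y"
| eval_Minz: "eval f (n # xs) 0 \<Longrightarrow> (\<forall>m<n. \<exists>v. eval f (m # xs) (Suc v))
               \<Longrightarrow> eval (Minz f) xs n"

definition computable1 :: "(nat \<Rightarrow> nat) \<Rightarrow> bool" where
  "computable1 f \<longleftrightarrow> (\<exists>r. \<forall>x. eval r [x] (f x))"

definition computable2 :: "(nat \<Rightarrow> nat \<Rightarrow> nat) \<Rightarrow> bool" where
  "computable2 f \<longleftrightarrow> (\<exists>r. \<forall>x y. eval r [x, y] (f x y))"

text \<open>Bijective coding of finite binary strings by natural numbers.\<close>
fun enc :: "bool list \<Rightarrow> nat" where
  "enc [] = 0"
| "enc (b # bs) = 2 * enc bs + (if b then 2 else 1)"

definition rat_of_code :: "nat \<Rightarrow> real" where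
  "rat_of_code k = (case prod_decode k of (a, b) \<Rightarrow> real_of_int (int_decode a) / real (Suc b))"

definition computable_real_fun :: "(bool list \<Rightarrow> real) \<Rightarrow> bool" where
  "computable_real_fun f \<longleftrightarrow>
     (\<exists>g. computable2 g \<and> (\<forall>\<sigma> n. \<bar>f \<sigma> - rat_of_code (g (enc \<sigma>) n)\<bar> \<le> 1 / 2 ^ n))"

text \<open>Elements of Cantor space are nat \<Rightarrow> bool; strings are bool list
  with the first bit first; \<sigma> @ [b] is the one-bit extension.\<close>

definition pre :: "(nat \<Rightarrow> bool) \<Rightarrow> nat \<Rightarrow> bool list" where
  "pre X n = map X [0..<n]"

definition cyl :: "bool list \<Rightarrow> (nat \<Rightarrow> bool) set" where
  "cyl \<tau> = {Y. pre Y (length \<tau>) = \<tau>}"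

definition mu :: "(nat \<Rightarrow> bool) measure" where
  "mu = PiM UNIV (\<lambda>_. measure_pmf (pmf_of_set (UNIV :: bool set)))"

definition computable_map :: "((nat \<Rightarrow> bool) \<Rightarrow> (nat \<Rightarrow> bool)) \<Rightarrow> bool" where
  "computable_map \<Phi> \<longleftrightarrow>
     (\<exists>h g. computable1 g \<and> (\<forall>\<sigma>. g (enc \<sigma>) = enc (h \<sigma>))
        \<and> (\<forall>\<sigma> \<sigma>'. prefix \<sigma> \<sigma>' \<longrightarrow> prefix (h \<sigma>) (h \<sigma>'))
        \<and> (\<forall>X n. h (pre X n) = pre (\<Phi> X) (length (h (pre X n))))
        \<and> (\<forall>X k. \<exists>n. k \<le> length (h (pre X n))))"

definition martingale :: "(bool list \<Rightarrow> real) \<Rightarrow> bool" where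
  "martingale m \<longleftrightarrow> (\<forall>\<sigma>. 0 \<le> m \<sigma>) \<and>
     (\<forall>\<sigma>. m (\<sigma> @ [False]) + m (\<sigma> @ [True]) = 2 * m \<sigma>)"

definition succeeds :: "(bool list \<Rightarrow> real) \<Rightarrow> (nat \<Rightarrow> bool) \<Rightarrow> bool" where
  "succeeds m X \<longleftrightarrow> limsup (\<lambda>n. ereal (m (pre X n))) = \<infinity>"

definition computably_random :: "(nat \<Rightarrow> bool) \<Rightarrow> bool" where
  "computably_random X \<longleftrightarrow>
     (\<nexists>m. martingale m \<and> computable_real_fun m \<and> succeeds m X)"

definition pushmeas :: "((nat \<Rightarrow> bool) \<Rightarrow> (nat \<Rightarrow> bool)) \<Rightarrow> bool list \<Rightarrow> real" where
  "pushmeas \<Phi> \<tau> = measure mu (\<Phi> -` cyl \<tau> \<inter> space mu)"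

definition phi_martingale ::
    "((nat \<Rightarrow> bool) \<Rightarrow> (nat \<Rightarrow> bool)) \<Rightarrow> (bool list \<Rightarrow> real) \<Rightarrow> bool" where
  "phi_martingale \<Phi> b \<longleftrightarrow> (\<forall>\<tau>. 0 \<le> b \<tau>) \<and>
     (\<forall>\<tau>. b \<tau> * pushmeas \<Phi> \<tau> =
           b (\<tau> @ [False]) * pushmeas \<Phi> (\<tau> @ [False])
         + b (\<tau> @ [True]) * pushmeas \<Phi> (\<tau> @ [True]))"

definition computably_random_wrt ::
    "((nat \<Rightarrow> bool) \<Rightarrow> (nat \<Rightarrow> bool)) \<Rightarrow> (nat \<Rightarrow> bool) \<Rightarrow> bool" where
  "computably_random_wrt \<Phi> Y \<longleftrightarrow>
     (\<nexists>b. phi_martingale \<Phi> b \<and> computable_real_fun b \<and> succeeds b Y)"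

end

theory Submission
  imports Defs
begin

text \<open>Let b be a computable \<open>\<Phi>\<close>-martingale succeeding on \<open>\<Phi> X\<close>. Repeatedly putting aside half of the
  capital turns b into a \<open>\<Phi>\<close>-martingale f that eventually stays above any given bound on all
  extensions of some prefix of \<open>\<Phi> X\<close>. By compactness and injectivity, the preimage of each
  sufficiently fine cylinder lies inside or outside a given cylinder \<open>[\<sigma>]\<close>; hence the average of
  f over \<open>[\<sigma>]\<close>, evaluated at the first N bits of the image, does not depend on N once N is large
  enough. These averages form a martingale. It is computable because a suitable N can be found by
  search, and it tends to infinity along X because f does so uniformly near \<open>\<Phi> X\<close>; without the
  saving step, the averages could be large while the values near X are small.\<close>

section \<open>Recursive functions on argument lists\<close>

text \<open>A cylinder \<open>cyl \<tau>\<close> may have a null preimage. There the fairness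
  equation leaves \<open>b \<tau>\<close> unconstrained, and conditional averages make no sense.
  Hence values are only weighted by \<open>joint \<sigma> \<tau>\<close>, the measure of the inputs
  in \<open>cyl \<sigma>\<close> sent into \<open>cyl \<tau>\<close>, and never divided by
  \<open>pushmeas\<close>. Likewise the lower bound for the saving martingale comes from bookkeeping
  and \<open>0 \<le> b \<tau>\<close>, not from fairness, so it holds on null cylinders too. No
  measure has to be approximated: with L input bits the average is a plain mean, over the strings
  \<rho> of length L extending \<sigma>, of the values at \<open>take N (h \<rho>)\<close>. That N
  is large enough is a statement about all pairs of infinite inputs, which a search cannot test. The
  search therefore looks for a pair (N, L) passing a finite test on the strings of length L, and
  compactness is what guarantees that such a pair exists.\<close>

definition recursive :: "nat \<Rightarrow> (nat list \<Rightarrow> nat) \<Rightarrow> bool" where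
  "recursive k f \<longleftrightarrow> (\<exists>r. \<forall>xs. length xs = k \<longrightarrow> eval r xs (f xs))"

text \<open>Arguments are accessed as \<open>hd xs\<close>, \<open>hd (tl xs)\<close>, and so on, and a binder prepends its variable
  to the argument list; this keeps the unification problems of the rules below higher-order patterns.\<close>

named_theorems rec_intros

lemma recursive_cong:
  assumes "recursive k f" "\<And>xs. length xs = k \<Longrightarrow> f xs = g xs"
  shows "recursive k g"
  using assms unfolding recursive_def by metis

lemma recursive_comp:
  assumes F: "recursive (length fs) F" and fs: "\<forall>f\<in>set fs. recursive k f"
  shows "recursive k (\<lambda>xs. F (map (\<lambda>f. f xs) fs))"
proof -
  obtain r where r: "\<And>xs. length xs = length fs \<Longrightarrow> eval r xs (F xs)"
    using F unfolding recursive_def by blast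
  have "\<forall>f\<in>set fs. \<exists>s. \<forall>xs. length xs = k \<longrightarrow> eval s xs (f xs)"
    using fs unfolding recursive_def by blast
  then obtain S where S: "\<And>f xs. f \<in> set fs \<Longrightarrow> length xs = k \<Longrightarrow> eval (S f) xs (f xs)"
    by metis
  have "eval (Comp r (map S fs)) xs (F (map (\<lambda>f. f xs) fs))" if "length xs = k" for xs
    by (rule eval_Comp[where ys = "map (\<lambda>f. f xs) fs"])
      (use that S r in \<open>auto simp: list_all2_conv_all_nth\<close>)
  then show ?thesis
    unfolding recursive_def by blast
qed

lemma recursive_comp1:
  assumes "recursive 1 (\<lambda>xs. F (hd xs))" "recursive k a"
  shows "recursive k (\<lambda>xs. F (a xs))"
  using recursive_comp[of "[a]" "\<lambda>xs. F (hd xs)" k] assms by simp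

lemma recursive_comp2:
  assumes "recursive 2 (\<lambda>xs. F (hd xs) (hd (tl xs)))" "recursive k a" "recursive k b"
  shows "recursive k (\<lambda>xs. F (a xs) (b xs))"
  using recursive_comp[of "[a, b]" "\<lambda>xs. F (hd xs) (hd (tl xs))" k] assms
  by (simp add: numeral_2_eq_2)

lemma recursive_comp3:
  assumes "recursive 3 (\<lambda>xs. F (hd xs) (hd (tl xs)) (hd (tl (tl xs))))"
    "recursive k a" "recursive k b" "recursive k c"
  shows "recursive k (\<lambda>xs. F (a xs) (b xs) (c xs))"
  using recursive_comp[of "[a, b, c]" "\<lambda>xs. F (hd xs) (hd (tl xs)) (hd (tl (tl xs)))" k] assms
  by (simp add: numeral_3_eq_3)

lemma recursive_computable1:
  assumes "computable1 F" shows "recursive 1 (\<lambda>xs. F (hd xs))"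
proof -
  obtain r where r: "\<And>x. eval r [x] (F x)"
    using assms unfolding computable1_def by blast
  have "eval r xs (F (hd xs))" if "length xs = 1" for xs
    using that r by (cases xs) auto
  then show ?thesis
    unfolding recursive_def by blast
qed

lemma recursive_computable2:
  assumes "computable2 F" shows "recursive 2 (\<lambda>xs. F (hd xs) (hd (tl xs)))"
proof -
  obtain r where r: "\<And>x y. eval r [x, y] (F x y)"
    using assms unfolding computable2_def by blast
  have "eval r xs (F (hd xs) (hd (tl xs)))" if "length xs = 2" for xs
    using that r by (cases xs; cases "tl xs") auto
  then show ?thesis
    unfolding recursive_def by blast
qed

lemma computable2I:
  assumes "recursive 2 (\<lambda>xs. F (hd xs) (hd (tl xs)))" shows "computable2 F"
proof -
  obtain r where r: "\<And>xs. length xs = 2 \<Longrightarrow> eval r xs (F (hd xs) (hd (tl xs)))"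
    using assms unfolding recursive_def by blast
  have "eval r [x, y] (F x y)" for x y
    using r[of "[x, y]"] by simp
  then show ?thesis
    unfolding computable2_def by blast
qed

lemma recursive_nth: "n < k \<Longrightarrow> recursive k (\<lambda>xs. xs ! n)"
  unfolding recursive_def by (metis eval_Proj)

lemma recursive_hd_drop: "n < k \<Longrightarrow> recursive k (\<lambda>xs. hd (drop n xs))"
  by (rule recursive_cong[OF recursive_nth]) (simp_all add: hd_drop_conv_nth)

lemma recursive_var [rec_intros]:
  "0 < k \<Longrightarrow> recursive k (\<lambda>xs. hd xs)"
  "1 < k \<Longrightarrow> recursive k (\<lambda>xs. hd (tl xs))"
  "2 < k \<Longrightarrow> recursive k (\<lambda>xs. hd (tl (tl xs)))"
  "3 < k \<Longrightarrow> recursive k (\<lambda>xs. hd (tl (tl (tl xs))))"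
  "4 < k \<Longrightarrow> recursive k (\<lambda>xs. hd (tl (tl (tl (tl xs)))))"
  using recursive_hd_drop[of 0 k] recursive_hd_drop[of 1 k] recursive_hd_drop[of 2 k]
    recursive_hd_drop[of 3 k] recursive_hd_drop[of 4 k]
  by (simp_all add: eval_nat_numeral drop_Suc)

lemma recursive_Suc [rec_intros]:
  assumes "recursive k a" shows "recursive k (\<lambda>xs. Suc (a xs))"
proof (rule recursive_comp1[OF _ assms])
  have "eval Succ xs (Suc (hd xs))" if "length xs = 1" for xs
    using that by (cases xs) (auto intro: eval_Succ)
  then show "recursive 1 (\<lambda>xs. Suc (hd xs))"
    unfolding recursive_def by blast
qed

lemma recursive_const [rec_intros]: "recursive k (\<lambda>xs. c)"
proof (induction c)
  case 0
  then show ?case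
    unfolding recursive_def using eval_Zero by blast
qed (rule recursive_Suc)

text \<open>\<open>Prec\<close> recurses on the head of its argument list, whereas here the bound
  \<open>f xs\<close> is computed from the parameters. So the \<open>Prec\<close> program is
  composed with f followed by all k projections.\<close>

lemma recursive_rec_nat [rec_intros]:
  assumes a: "recursive k a"
    and g: "recursive (Suc (Suc k)) (\<lambda>xs. g (hd xs) (hd (tl xs)) (tl (tl xs)))"
    and f: "recursive k f"
  shows "recursive k (\<lambda>xs. rec_nat (a xs) (\<lambda>n z. g n z xs) (f xs))"
proof -
  obtain ra where ra: "\<And>xs. length xs = k \<Longrightarrow> eval ra xs (a xs)"
    using a unfolding recursive_def by blast
  obtain rg where rg: "\<And>xs. length xs = Suc (Suc k) \<Longrightarrow>
      eval rg xs (g (hd xs) (hd (tl xs)) (tl (tl xs)))"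
    using g unfolding recursive_def by blast
  let ?R = "\<lambda>xs. rec_nat (a (tl xs)) (\<lambda>n z. g n z (tl xs)) (hd xs)"
  have ev: "eval (Prec ra rg) (n # ys) (rec_nat (a ys) (\<lambda>n z. g n z ys) n)"
    if "length ys = k" for n ys
  proof (induction n)
    case 0
    show ?case
      using eval_Prec0[OF ra[OF that]] by simp
  next
    case (Suc n)
    show ?case
      using eval_PrecS[OF Suc rg] that by simp
  qed
  have "recursive (Suc k) ?R"
    unfolding recursive_def
  proof (intro exI[of _ "Prec ra rg"] allI impI)
    fix xs :: "nat list"
    assume "length xs = Suc k"
    then obtain n ys where "xs = n # ys" "length ys = k"
      by (cases xs) auto
    then show "eval (Prec ra rg) xs (?R xs)"
      using ev by simp
  qed
  moreover have "\<forall>h\<in>set (f # map (\<lambda>i xs. xs ! i) [0..<k]). recursive k h"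
    using f by (auto intro: recursive_nth)
  ultimately have "recursive k (\<lambda>xs. ?R (map (\<lambda>h. h xs) (f # map (\<lambda>i xs. xs ! i) [0..<k])))"
    by (intro recursive_comp) auto
  then show ?thesis
    by (rule recursive_cong) (auto simp: o_def map_nth)
qed

lemma recursive_Least [rec_intros]:
  assumes p: "recursive (Suc k) (\<lambda>xs. p (hd xs) (tl xs))"
    and ex: "\<And>xs. length xs = k \<Longrightarrow> \<exists>n. p n xs = 0"
  shows "recursive k (\<lambda>xs. LEAST n. p n xs = 0)"
proof -
  obtain r where r: "\<And>xs. length xs = Suc k \<Longrightarrow> eval r xs (p (hd xs) (tl xs))"
    using p unfolding recursive_def by blast
  have "eval (Minz r) xs (LEAST n. p n xs = 0)" if len: "length xs = k" for xs
  proof (rule eval_Minz)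
    show "eval r ((LEAST n. p n xs = 0) # xs) 0"
      using r[of "(LEAST n. p n xs = 0) # xs"] len LeastI_ex[OF ex[OF len]] by simp
    show "\<forall>m<LEAST n. p n xs = 0. \<exists>v. eval r (m # xs) (Suc v)"
    proof (intro allI impI)
      fix m
      assume "m < (LEAST n. p n xs = 0)"
      then have "p m xs \<noteq> 0"
        by (rule not_less_Least)
      then show "\<exists>v. eval r (m # xs) (Suc v)"
        using r[of "m # xs"] len by (auto simp: gr0_conv_Suc)
    qed
  qed
  then show ?thesis
    unfolding recursive_def by blast
qed

lemma recursive_add [rec_intros]:
  assumes "recursive k a" "recursive k b" shows "recursive k (\<lambda>xs. a xs + b xs)"
proof (rule recursive_comp2[OF _ assms])
  have "recursive 2 (\<lambda>xs. rec_nat (hd xs) (\<lambda>n z. Suc z) (hd (tl xs)))"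
    by (intro rec_intros) auto
  moreover have "rec_nat x (\<lambda>n z. Suc z) y = x + y" for x y
    by (induction y) auto
  ultimately show "recursive 2 (\<lambda>xs. hd xs + hd (tl xs))"
    by simp
qed

lemma recursive_mult [rec_intros]:
  assumes "recursive k a" "recursive k b" shows "recursive k (\<lambda>xs. a xs * b xs)"
proof (rule recursive_comp2[OF _ assms])
  have "recursive 2 (\<lambda>xs. rec_nat 0 (\<lambda>n z. z + hd xs) (hd (tl xs)))"
    by (intro rec_intros) auto
  moreover have "rec_nat 0 (\<lambda>n z. z + x) y = x * y" for x y :: nat
    by (induction y) auto
  ultimately show "recursive 2 (\<lambda>xs. hd xs * hd (tl xs))"
    by simp
qed

lemma recursive_diff [rec_intros]:
  assumes "recursive k a" "recursive k b" shows "recursive k (\<lambda>xs. a xs - b xs)"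
proof (rule recursive_comp2[OF _ assms])
  have pred: "recursive k (\<lambda>xs. h xs - 1)" if h: "recursive k h" for k h
  proof (rule recursive_comp1[OF _ h])
    have "recursive 1 (\<lambda>xs. rec_nat 0 (\<lambda>n z. n) (hd xs))"
      by (intro rec_intros) auto
    moreover have "rec_nat 0 (\<lambda>n z. n) y = y - 1" for y
      by (cases y) auto
    ultimately show "recursive 1 (\<lambda>xs. hd xs - 1)"
      by simp
  qed
  have "recursive 2 (\<lambda>xs. rec_nat (hd xs) (\<lambda>n z. z - 1) (hd (tl xs)))"
    by (intro rec_intros pred) auto
  moreover have "rec_nat x (\<lambda>n z. z - 1) y = x - y" for x y
    by (induction y) auto
  ultimately show "recursive 2 (\<lambda>xs. hd xs - hd (tl xs))"
    by simp
qed

lemma recursive_power [rec_intros]: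
  assumes "recursive k a" "recursive k b" shows "recursive k (\<lambda>xs. a xs ^ b xs)"
proof (rule recursive_comp2[OF _ assms])
  have "recursive 2 (\<lambda>xs. rec_nat 1 (\<lambda>n z. z * hd xs) (hd (tl xs)))"
    by (intro rec_intros) auto
  moreover have "rec_nat 1 (\<lambda>n z. z * x) y = x ^ y" for x y :: nat
    by (induction y) auto
  ultimately show "recursive 2 (\<lambda>xs. hd xs ^ hd (tl xs))"
    by simp
qed

lemma recursive_sum [rec_intros]:
  assumes "recursive k f" "recursive (Suc k) (\<lambda>xs. g (hd xs) (tl xs))"
  shows "recursive k (\<lambda>xs. \<Sum>i<f xs. g i xs)"
proof -
  let ?g = "\<lambda>xs. g (hd xs) (tl xs)"
  \<comment> \<open>The recursion step sees the list \<open>n # z # xs\<close>; these projections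
    skip position 1, the accumulator z, on which the summand does not depend.\<close>
  have "\<forall>h\<in>set (map (\<lambda>i xs. xs ! (if i = 0 then 0 else Suc i)) [0..<Suc k]).
      recursive (Suc (Suc k)) h"
    by (auto intro!: recursive_nth)
  then have "recursive (Suc (Suc k))
      (\<lambda>xs. ?g (map (\<lambda>h. h xs) (map (\<lambda>i xs. xs ! (if i = 0 then 0 else Suc i)) [0..<Suc k])))"
    using assms(2) by (intro recursive_comp) auto
  then have "recursive (Suc (Suc k)) (\<lambda>xs. g (hd xs) (tl (tl xs)))"
  proof (rule recursive_cong)
    fix xs :: "nat list"
    assume "length xs = Suc (Suc k)"
    then obtain x y ys where xs: "xs = x # y # ys" "length ys = k"
      by (cases xs; cases "tl xs") auto
    then have "map (\<lambda>h. h xs) (map (\<lambda>i xs. xs ! (if i = 0 then 0 else Suc i)) [0..<Suc k])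
        = x # ys"
      by (intro nth_equalityI) (auto simp: nth_Cons' simp del: upt_Suc)
    then show "?g (map (\<lambda>h. h xs) (map (\<lambda>i xs. xs ! (if i = 0 then 0 else Suc i)) [0..<Suc k]))
        = g (hd xs) (tl (tl xs))"
      by (simp only: xs(1) list.sel)
  qed
  then have "recursive k (\<lambda>xs. rec_nat 0 (\<lambda>n z. z + g n xs) (f xs))"
    by (intro rec_intros assms(1)) auto
  moreover have "rec_nat 0 (\<lambda>n z. z + g n xs) y = (\<Sum>i<y. g i xs)" for xs y
    by (induction y) auto
  ultimately show ?thesis
    by simp
qed

section \<open>Decidable predicates and bounded quantification\<close>

definition decidable :: "nat \<Rightarrow> (nat list \<Rightarrow> bool) \<Rightarrow> bool" where
  "decidable k P \<longleftrightarrow> recursive k (\<lambda>xs. if P xs then 1 else 0)"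

lemma recursive_of_decidable:
  "decidable k P \<Longrightarrow> recursive k (\<lambda>xs. if P xs then 1 else 0)"
  by (simp add: decidable_def)

lemma recursive_if [rec_intros]:
  assumes "decidable k P" "recursive k a" "recursive k b"
  shows "recursive k (\<lambda>xs. if P xs then a xs else b xs)"
proof -
  have "recursive k (\<lambda>xs. (if P xs then 1 else 0) * a xs + (1 - (if P xs then 1 else 0)) * b xs)"
    by (intro rec_intros assms recursive_of_decidable)
  then show ?thesis
    by (rule recursive_cong) auto
qed

lemma decidable_less [rec_intros]:
  assumes "recursive k a" "recursive k b" shows "decidable k (\<lambda>xs. a xs < b xs)"
proof -
  have "recursive k (\<lambda>xs. 1 - (1 - (b xs - a xs)))"
    by (intro rec_intros assms)
  then show ?thesis
    unfolding decidable_def by (rule recursive_cong) auto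
qed

lemma decidable_not [rec_intros]:
  assumes "decidable k P" shows "decidable k (\<lambda>xs. \<not> P xs)"
proof -
  have "recursive k (\<lambda>xs. if P xs then 0 else 1)"
    by (intro rec_intros assms)
  then show ?thesis
    unfolding decidable_def by (rule recursive_cong) auto
qed

lemma decidable_conj [rec_intros]:
  assumes "decidable k P" "decidable k Q" shows "decidable k (\<lambda>xs. P xs \<and> Q xs)"
proof -
  have "recursive k (\<lambda>xs. if P xs then if Q xs then 1 else 0 else 0)"
    by (intro rec_intros assms)
  then show ?thesis
    unfolding decidable_def by (rule recursive_cong) auto
qed

lemma decidable_imp [rec_intros]:
  assumes "decidable k P" "decidable k Q" shows "decidable k (\<lambda>xs. P xs \<longrightarrow> Q xs)"
proof -
  have "recursive k (\<lambda>xs. if P xs then if Q xs then 1 else 0 else 1)"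
    by (intro rec_intros assms)
  then show ?thesis
    unfolding decidable_def by (rule recursive_cong) auto
qed

lemma decidable_le [rec_intros]:
  assumes "recursive k a" "recursive k b" shows "decidable k (\<lambda>xs. a xs \<le> b xs)"
  using decidable_not[OF decidable_less[OF assms(2,1)]] by (simp add: not_less)

lemma decidable_eq [rec_intros]:
  assumes "recursive k a" "recursive k b" shows "decidable k (\<lambda>xs. a xs = b xs)"
proof -
  have "decidable k (\<lambda>xs. a xs \<le> b xs \<and> b xs \<le> a xs)"
    by (intro rec_intros assms)
  then show ?thesis
    by (simp add: order_eq_iff)
qed

lemma decidable_all_less [rec_intros]:
  assumes "recursive k f" "decidable (Suc k) (\<lambda>xs. P (hd xs) (tl xs))"
  shows "decidable k (\<lambda>xs. \<forall>i<f xs. P i xs)"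
proof -
  have "decidable k (\<lambda>xs. (\<Sum>i<f xs. if P i xs then 0 else 1) = (0 :: nat))"
    by (intro rec_intros assms)
  moreover have "(\<Sum>i<n. if P i xs then 0 else (1 :: nat)) = 0 \<longleftrightarrow> (\<forall>i<n. P i xs)" for n xs
    by auto
  ultimately show ?thesis
    by simp
qed

text \<open>The quotient counts the positive multiples of y up to x; the guard \<open>0 < y\<close>
  reproduces the convention that division by 0 gives 0.\<close>

lemma div_eq_sum: "x div y = (\<Sum>i<x. if 0 < y \<and> Suc i * y \<le> x then 1 else (0::nat))"
proof (cases "y = 0")
  case False
  have "(\<Sum>i<x. if 0 < y \<and> Suc i * y \<le> x then 1 else (0::nat)) = (\<Sum>i<x. if i < x div y then 1 else 0)"
    using False by (intro sum.cong) (auto simp: less_eq_div_iff_mult_less_eq simp flip: Suc_le_eq)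
  also have "\<dots> = card ({..<x} \<inter> {i. i < x div y})"
    by (subst card_eq_sum) (simp only: sum.inter_restrict finite_lessThan mem_Collect_eq)
  also have "{..<x} \<inter> {i. i < x div y} = {..<x div y}"
    by (auto intro: less_le_trans)
  finally show ?thesis
    by simp
qed auto

lemma recursive_div [rec_intros]:
  assumes "recursive k a" "recursive k b" shows "recursive k (\<lambda>xs. a xs div b xs)"
proof (rule recursive_comp2[OF _ assms])
  show "recursive 2 (\<lambda>xs. hd xs div hd (tl xs))"
    unfolding div_eq_sum by (intro rec_intros) auto
qed

lemma recursive_mod [rec_intros]:
  assumes "recursive k a" "recursive k b" shows "recursive k (\<lambda>xs. a xs mod b xs)"
proof -
  have "recursive k (\<lambda>xs. a xs - a xs div b xs * b xs)"
    by (intro rec_intros assms)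
  then show ?thesis
    by (simp add: minus_div_mult_eq_mod)
qed

lemma recursive_prod_encode [rec_intros]:
  assumes "recursive k a" "recursive k b" shows "recursive k (\<lambda>xs. prod_encode (a xs, b xs))"
  unfolding prod_encode_def triangle_def case_prod_conv by (intro rec_intros assms)

text \<open>Both components of a pair are at most its code, so a bounded double sum meets the
  decoded pair, and injectivity of \<open>prod_encode\<close> leaves only that summand.\<close>

lemma sum_prod_decode:
  "(\<Sum>a<Suc n. \<Sum>b<Suc n. if prod_encode (a, b) = n then f a b else 0)
    = (case prod_decode n of (a, b) \<Rightarrow> (f a b :: nat))"
proof -
  obtain a b where ab: "prod_decode n = (a, b)"
    by force
  then have n: "n = prod_encode (a, b)"
    by (metis prod_decode_inverse)
  have lt: "a < Suc n" "b < Suc n"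
    using le_prod_encode_1[of a b] le_prod_encode_2[of b a] n by auto
  have "(\<Sum>x<Suc n. \<Sum>y<Suc n. if prod_encode (x, y) = n then f x y else 0)
      = (\<Sum>x<Suc n. if x = a then f a b else 0)"
    using lt by (intro sum.cong refl) (simp add: n sum.delta del: sum.lessThan_Suc)
  then show ?thesis
    using lt by (simp add: ab sum.delta del: sum.lessThan_Suc)
qed

lemma recursive_prod_decode [rec_intros]:
  assumes "recursive k a"
  shows "recursive k (\<lambda>xs. fst (prod_decode (a xs)))"
    and "recursive k (\<lambda>xs. snd (prod_decode (a xs)))"
proof -
  have eq: "fst (prod_decode n) = (\<Sum>a<Suc n. \<Sum>b<Suc n. if prod_encode (a, b) = n then a else 0)"
    "snd (prod_decode n) = (\<Sum>a<Suc n. \<Sum>b<Suc n. if prod_encode (a, b) = n then b else 0)" for n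
    unfolding sum_prod_decode by (simp_all add: case_prod_beta)
  have "recursive 1 (\<lambda>xs. fst (prod_decode (hd xs)))"
    unfolding eq by (intro rec_intros) auto
  then show "recursive k (\<lambda>xs. fst (prod_decode (a xs)))"
    by (rule recursive_comp1) (rule assms)
  have "recursive 1 (\<lambda>xs. snd (prod_decode (hd xs)))"
    unfolding eq by (intro rec_intros) auto
  then show "recursive k (\<lambda>xs. snd (prod_decode (a xs)))"
    by (rule recursive_comp1) (rule assms)
qed

section \<open>Arithmetic of string codes\<close>

text \<open>Hence \<open>Suc (enc \<sigma>)\<close> is, in binary, a leading 1 above the bits of
  \<sigma>, the first bit being the least significant. All string arithmetic below uses this
  increased code.\<close>

lemma Suc_enc_Cons: "Suc (enc (b # bs)) = 2 * Suc (enc bs) + of_bool b"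
  by simp

lemma Suc_enc_bounds: "2 ^ length \<sigma> \<le> Suc (enc \<sigma>) \<and> Suc (enc \<sigma>) < 2 ^ Suc (length \<sigma>)"
  by (induction \<sigma>) auto

text \<open>A prefix consists of the n low-order binary digits; \<open>2 ^ n\<close> restores the
  leading 1.\<close>

lemma Suc_enc_take:
  "n \<le> length \<sigma> \<Longrightarrow> Suc (enc (take n \<sigma>)) = 2 ^ n + Suc (enc \<sigma>) mod 2 ^ n"
proof (induction n arbitrary: \<sigma>)
  case (Suc n)
  then obtain b bs where \<sigma>: "\<sigma> = b # bs" "n \<le> length bs"
    by (cases \<sigma>) auto
  have "(2 * x + of_bool b) mod (2 * 2 ^ n) = 2 * (x mod 2 ^ n) + of_bool b" for x :: nat
    by (cases b) (auto simp: mod_mult2_eq mod_Suc double_not_eq_Suc_double)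
  then have "Suc (enc \<sigma>) mod 2 ^ Suc n = 2 * (Suc (enc bs) mod 2 ^ n) + of_bool b"
    unfolding \<sigma>(1) Suc_enc_Cons power_Suc by blast
  moreover have "Suc (enc (take (Suc n) \<sigma>)) = 2 * Suc (enc (take n bs)) + of_bool b"
    unfolding \<sigma>(1) take_Suc_Cons Suc_enc_Cons ..
  ultimately show ?case
    using Suc.IH[OF \<sigma>(2)] by simp
qed auto

lemma enc_inj: "enc \<sigma> = enc \<tau> \<Longrightarrow> \<sigma> = \<tau>"
proof (induction \<sigma> arbitrary: \<tau>)
  case Nil
  then show ?case
    by (cases \<tau>) (auto split: if_splits)
next
  case (Cons b bs)
  then obtain c cs where \<tau>: "\<tau> = c # cs"
    by (cases \<tau>) (auto split: if_splits)
  have "b = c \<and> enc bs = enc cs"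
    using Cons.prems unfolding \<tau> by (cases b; cases c; simp; arith)
  then show ?case
    using Cons.IH \<tau> by simp
qed

lemma finite_strings [simp]: "finite {\<sigma> :: bool list. length \<sigma> = n}"
  using finite_lists_length_eq[of "UNIV :: bool set" n] by simp

lemma card_strings: "card {\<sigma> :: bool list. length \<sigma> = n} = 2 ^ n"
  using card_lists_length_eq[of "UNIV :: bool set" n] by simp

lemma strings_Suc:
  "{\<sigma> :: bool list. length \<sigma> = Suc n}
    = (\<lambda>\<sigma>. \<sigma> @ [False]) ` {\<sigma>. length \<sigma> = n} \<union> (\<lambda>\<sigma>. \<sigma> @ [True]) ` {\<sigma>. length \<sigma> = n}"
proof (intro equalityI subsetI)
  fix \<sigma> :: "bool list"
  assume \<sigma>: "\<sigma> \<in> {\<sigma>. length \<sigma> = Suc n}"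
  then obtain \<tau> b where \<tau>: "\<sigma> = \<tau> @ [b]" "length \<tau> = n"
    by (cases \<sigma> rule: rev_cases) auto
  show "\<sigma> \<in> (\<lambda>\<sigma>. \<sigma> @ [False]) ` {\<sigma>. length \<sigma> = n} \<union> (\<lambda>\<sigma>. \<sigma> @ [True]) ` {\<sigma>. length \<sigma> = n}"
  proof (cases b)
    case True
    then show ?thesis
      using \<tau> by (intro UnI2 image_eqI[of _ _ \<tau>]) simp_all
  next
    case False
    then show ?thesis
      using \<tau> by (intro UnI1 image_eqI[of _ _ \<tau>]) simp_all
  qed
qed (elim UnE imageE; simp)

text \<open>Removing the leading 1 is injective on strings of length n, and source and target both
  have \<open>2 ^ n\<close> elements. This turns sums and quantifiers over strings into bounded ones
  over numbers.\<close>

lemma bij_betw_enc: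
  "bij_betw (\<lambda>\<sigma>. Suc (enc \<sigma>) - 2 ^ n) {\<sigma>. length \<sigma> = n} {..<2 ^ n}"
proof -
  have inj: "inj_on (\<lambda>\<sigma>. Suc (enc \<sigma>) - 2 ^ n) {\<sigma>. length \<sigma> = n}"
  proof (rule inj_onI)
    fix \<sigma> \<tau> :: "bool list"
    assume "\<sigma> \<in> {\<sigma>. length \<sigma> = n}" "\<tau> \<in> {\<sigma>. length \<sigma> = n}"
      "Suc (enc \<sigma>) - 2 ^ n = Suc (enc \<tau>) - 2 ^ n"
    then have "enc \<sigma> = enc \<tau>"
      using Suc_enc_bounds[of \<sigma>] Suc_enc_bounds[of \<tau>] by simp linarith
    then show "\<sigma> = \<tau>"
      by (rule enc_inj)
  qed
  have "(\<lambda>\<sigma>. Suc (enc \<sigma>) - 2 ^ n) ` {\<sigma>. length \<sigma> = n} \<subseteq> {..<2 ^ n}"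
  proof (rule image_subsetI)
    fix \<sigma> :: "bool list"
    assume "\<sigma> \<in> {\<sigma>. length \<sigma> = n}"
    then show "Suc (enc \<sigma>) - 2 ^ n \<in> {..<2 ^ n}"
      using Suc_enc_bounds[of \<sigma>] by auto
  qed
  then have "(\<lambda>\<sigma>. Suc (enc \<sigma>) - 2 ^ n) ` {\<sigma>. length \<sigma> = n} = {..<2 ^ n}"
    by (intro card_subset_eq) (simp_all add: card_image[OF inj] card_strings)
  with inj show ?thesis
    by (simp add: bij_betw_def)
qed

lemma sum_strings_enc:
  "(\<Sum>\<sigma> | length \<sigma> = n. f (Suc (enc \<sigma>))) = (\<Sum>r<2 ^ n. f (2 ^ n + r))"
proof -
  have "(\<Sum>\<sigma> | length \<sigma> = n. f (Suc (enc \<sigma>)))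
      = (\<Sum>\<sigma> | length \<sigma> = n. f (2 ^ n + (Suc (enc \<sigma>) - 2 ^ n)))"
    using Suc_enc_bounds by (intro sum.cong) auto
  then show ?thesis
    using sum.reindex_bij_betw[OF bij_betw_enc, of "\<lambda>r. f (2 ^ n + r)" n] by simp
qed

lemma all_strings_enc:
  "(\<forall>\<sigma>. length \<sigma> = n \<longrightarrow> P (Suc (enc \<sigma>))) \<longleftrightarrow> (\<forall>r<2 ^ n. P (2 ^ n + r))"
proof -
  have "Suc (enc \<sigma>) = 2 ^ n + (Suc (enc \<sigma>) - 2 ^ n)" if "length \<sigma> = n" for \<sigma>
    using Suc_enc_bounds[of \<sigma>] that by simp
  then show ?thesis
    using bij_betw_imp_surj_on[OF bij_betw_enc[of n]]
    by (smt (verit) imageE imageI lessThan_iff mem_Collect_eq)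
qed

text \<open>For positive e this is the binary logarithm rounded down, written as a bounded sum so
  that it is visibly recursive.\<close>

definition code_length :: "nat \<Rightarrow> nat" where
  "code_length e = (\<Sum>i<e. if 2 ^ Suc i \<le> e then 1 else 0)"

lemma code_length_enc [simp]: "code_length (Suc (enc \<sigma>)) = length \<sigma>"
proof -
  let ?e = "Suc (enc \<sigma>)"
  have "2 ^ Suc i \<le> ?e \<longleftrightarrow> i < length \<sigma>" for i
  proof
    assume "2 ^ Suc i \<le> ?e"
    then have "(2 :: nat) ^ Suc i < 2 ^ Suc (length \<sigma>)"
      using Suc_enc_bounds[of \<sigma>] by linarith
    then show "i < length \<sigma>"
      by simp
  next
    assume "i < length \<sigma>"
    then have "(2 :: nat) ^ Suc i \<le> 2 ^ length \<sigma>"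
      by (intro power_increasing) auto
    then show "2 ^ Suc i \<le> ?e"
      using Suc_enc_bounds[of \<sigma>] by linarith
  qed
  then have "code_length ?e = (\<Sum>i<?e. if i < length \<sigma> then 1 else 0)"
    unfolding code_length_def by simp
  also have "\<dots> = card ({..<?e} \<inter> {i. i < length \<sigma>})"
    by (subst card_eq_sum) (simp only: sum.inter_restrict finite_lessThan mem_Collect_eq)
  also have "{..<?e} \<inter> {i. i < length \<sigma>} = {..<length \<sigma>}"
  proof -
    have "length \<sigma> < 2 ^ length \<sigma>"
      by (rule less_exp)
    then have "length \<sigma> < ?e"
      using Suc_enc_bounds[of \<sigma>] by linarith
    then show ?thesis
      by auto
  qed
  finally show ?thesis
    by simp
qed

lemma recursive_code_length [rec_intros]:
  assumes "recursive k a" shows "recursive k (\<lambda>xs. code_length (a xs))"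
proof (rule recursive_comp1[OF _ assms])
  show "recursive 1 (\<lambda>xs. code_length (hd xs))"
    unfolding code_length_def by (intro rec_intros) auto
qed

section \<open>Cantor space\<close>

lemma length_pre [simp]: "length (pre X n) = n"
  by (simp add: pre_def)

lemma take_pre [simp]: "k \<le> n \<Longrightarrow> take k (pre X n) = pre X k"
  by (simp add: pre_def take_map)

lemma pre_Suc: "pre X (Suc n) = pre X n @ [X n]"
  by (simp add: pre_def)

lemma pre_eq_iff: "pre X n = pre Y n \<longleftrightarrow> (\<forall>i<n. X i = Y i)"
  by (auto simp: pre_def)

lemma cyl_nonempty: "\<exists>X. X \<in> cyl \<sigma>"
proof
  show "(\<lambda>i. i < length \<sigma> \<and> \<sigma> ! i) \<in> cyl \<sigma>"
    by (auto simp: cyl_def pre_def intro: nth_equalityI)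
qed

lemma in_cyl_snoc: "X \<in> cyl (\<sigma> @ [b]) \<longleftrightarrow> X \<in> cyl \<sigma> \<and> X (length \<sigma>) = b"
  by (simp add: cyl_def pre_Suc)

lemma cyl_append: "cyl \<sigma> = cyl (\<sigma> @ [False]) \<union> cyl (\<sigma> @ [True])"
  using in_cyl_snoc by blast

lemma cyl_disjoint:
  "length \<sigma> = length \<tau> \<Longrightarrow> \<sigma> \<noteq> \<tau> \<Longrightarrow> cyl \<sigma> \<inter> cyl \<tau> = {}"
  by (auto simp: cyl_def)

lemma cyl_append_disjoint: "cyl (\<sigma> @ [False]) \<inter> cyl (\<sigma> @ [True]) = {}"
  by (rule cyl_disjoint) auto

text \<open>Sequential compactness of the sequence space over a finite alphabet: the pigeonhole
  principle gives nested infinite index sets on which ever more coordinates are constant. The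
  alphabet is arbitrary because pairs of binary sequences are needed as well.\<close>

lemma cluster_sequence:
  fixes Z :: "nat \<Rightarrow> nat \<Rightarrow> 'a :: finite"
  shows "\<exists>W. \<forall>k n0. \<exists>n\<ge>n0. \<forall>i<k. Z n i = W i"
proof -
  define P where "P k I \<longleftrightarrow> infinite I \<and> (\<forall>n\<in>I. \<forall>n'\<in>I. \<forall>i<k. Z n i = Z n' i)" for k I
  have "\<exists>I. \<forall>k. P k (I k) \<and> I (Suc k) \<subseteq> I k"
  proof (rule dependent_nat_choice)
    show "\<exists>I. P 0 I"
      by (auto simp: P_def)
    fix I k
    assume I: "P k I"
    have "\<exists>n\<in>I. infinite {n'\<in>I. Z n' k = Z n k}"
      using I by (intro pigeonhole_infinite) (auto simp: P_def)
    then obtain n where "infinite {n'\<in>I. Z n' k = Z n k}"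
      by blast
    then show "\<exists>I'. P (Suc k) I' \<and> I' \<subseteq> I"
      using I by (intro exI[of _ "{n'\<in>I. Z n' k = Z n k}"]) (auto simp: P_def less_Suc_eq)
  qed
  then obtain I where I: "\<And>k. P k (I k)" and step: "\<And>k. I (Suc k) \<subseteq> I k"
    by blast
  have anti: "I k' \<subseteq> I k" if "k \<le> k'" for k k'
    using lift_Suc_antimono_le[of I, OF step that] .
  have "\<exists>n. n \<in> I k" for k
    using I[of k] by (auto simp: P_def dest: infinite_imp_nonempty)
  then obtain c where c: "\<And>k. c k \<in> I k"
    by metis
  \<comment> \<open>The cluster point is diagonal: coordinate i is read off any member of
    \<open>I (Suc i)\<close>, since all of them agree at i.\<close>
  have "\<exists>n\<ge>n0. \<forall>i<k. Z n i = Z (c (Suc i)) i" for k n0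
  proof -
    obtain n where n: "n \<ge> n0" "n \<in> I k"
      using I[of k] unfolding P_def by (meson infinite_nat_iff_unbounded_le)
    have "Z n i = Z (c (Suc i)) i" if "i < k" for i
    proof -
      have "n \<in> I (Suc i)"
        using anti[of "Suc i" k] n(2) that by auto
      then show ?thesis
        using I[of "Suc i"] c[of "Suc i"] unfolding P_def by blast
    qed
    then show ?thesis
      using n by blast
  qed
  then show ?thesis
    by (intro exI[of _ "\<lambda>i. Z (c (Suc i)) i"]) blast
qed

section \<open>The uniform measure of cylinders\<close>

interpretation coins: product_prob_space
  "\<lambda>_ :: nat. measure_pmf (pmf_of_set (UNIV :: bool set))" UNIV
  ..

interpretation mu: prob_space mu
  unfolding mu_def by (rule coins.P.prob_space_axioms)

lemma space_mu [simp]: "space mu = UNIV"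
  by (simp add: mu_def space_PiM)

lemma cyl_eq_Collect:
  "cyl \<sigma> = {X \<in> space (PiM UNIV (\<lambda>_. measure_pmf (pmf_of_set (UNIV :: bool set)))).
      \<forall>i\<in>{..<length \<sigma>}. X i \<in> {\<sigma> ! i}}"
proof -
  have "pre X (length \<sigma>) = \<sigma> \<longleftrightarrow> (\<forall>i\<in>{..<length \<sigma>}. X i \<in> {\<sigma> ! i})" for X
    unfolding list_eq_iff_nth_eq[of "pre X (length \<sigma>)" \<sigma>] by (simp add: pre_def Ball_def)
  then show ?thesis
    by (simp add: cyl_def space_PiM)
qed

lemma cyl_measurable [measurable]: "cyl \<sigma> \<in> sets mu"
  unfolding cyl_eq_Collect mu_def by (intro sets.sets_Collect_finite_All sets_Collect_single') auto

lemma measure_cyl: "measure mu (cyl \<sigma>) = 1 / 2 ^ length \<sigma>"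
proof -
  have "emeasure mu (cyl \<sigma>)
      = (\<Prod>i<length \<sigma>. emeasure (measure_pmf (pmf_of_set (UNIV :: bool set))) {\<sigma> ! i})"
    unfolding cyl_eq_Collect mu_def by (intro coins.emeasure_PiM_Collect) auto
  also have "\<dots> = (\<Prod>i<length \<sigma>. ennreal (1 / 2))"
    by (intro prod.cong) (simp_all add: emeasure_pmf_single)
  also have "\<dots> = ennreal (1 / 2 ^ length \<sigma>)"
    by (simp only: prod_constant card_lessThan ennreal_power zero_le_divide_1_iff zero_le_numeral
        power_one_over)
  finally show ?thesis
    by (simp add: measure_def)
qed

section \<open>Continuous maps given by monotone string functions\<close>

text \<open>Only the continuity of \<Phi> is recorded here; computability and injectivity become
  locale assumptions in \<open>computable_injection\<close>.\<close>

locale monotone_approximation =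
  fixes h :: "bool list \<Rightarrow> bool list" and \<Phi> :: "(nat \<Rightarrow> bool) \<Rightarrow> nat \<Rightarrow> bool"
  assumes h_mono: "prefix \<sigma> \<sigma>' \<Longrightarrow> prefix (h \<sigma>) (h \<sigma>')"
    and h_approx: "h (pre X n) = pre (\<Phi> X) (length (h (pre X n)))"
    and h_unbounded: "\<exists>n. k \<le> length (h (pre X n))"
begin

definition long_enough :: "nat \<Rightarrow> nat \<Rightarrow> bool" where
  "long_enough N L \<longleftrightarrow> (\<forall>\<rho>. length \<rho> = L \<longrightarrow> N \<le> length (h \<rho>))"

text \<open>A modulus of uniform continuity for the inverse of \<Phi>.\<close>

definition resolves :: "nat \<Rightarrow> nat \<Rightarrow> bool" where
  "resolves N l \<longleftrightarrow> (\<forall>X Y. pre X l \<noteq> pre Y l \<longrightarrow> pre (\<Phi> X) N \<noteq> pre (\<Phi> Y) N)"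

text \<open>A finite certificate for \<open>resolves\<close>: the first N output bits of any input
  can be read from h at its prefix of length L, so comparing strings of length L covers all infinite
  inputs.\<close>

definition string_resolves :: "nat \<Rightarrow> nat \<Rightarrow> nat \<Rightarrow> bool" where
  "string_resolves N L l \<longleftrightarrow> l \<le> L \<and> long_enough N L \<and>
    (\<forall>\<rho>. length \<rho> = L \<longrightarrow> (\<forall>\<rho>'. length \<rho>' = L \<longrightarrow>
      take l \<rho> \<noteq> take l \<rho>' \<longrightarrow> take N (h \<rho>) \<noteq> take N (h \<rho>')))"

lemma pre_Phi:
  assumes "N \<le> length (h (pre X L))" shows "pre (\<Phi> X) N = take N (h (pre X L))"
proof -
  have "take N (h (pre X L)) = take N (pre (\<Phi> X) (length (h (pre X L))))"
    using h_approx by (rule arg_cong)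
  also have "\<dots> = pre (\<Phi> X) N"
    using assms by (rule take_pre)
  finally show ?thesis ..
qed

lemma h_pre_mono:
  assumes "k \<le> L" shows "length (h (pre X k)) \<le> length (h (pre X L))"
proof -
  have "prefix (pre X k) (pre X L)"
    using take_is_prefix[of k "pre X L"] take_pre[OF assms] by (simp only:)
  then show ?thesis
    by (rule h_mono[THEN prefix_length_le])
qed

lemma pre_surj: "length \<rho> = L \<Longrightarrow> \<exists>X. pre X L = \<rho>"
  using cyl_nonempty[of \<rho>] by (simp add: cyl_def)

lemma long_enough_mono:
  assumes "long_enough N L" "L \<le> L'" shows "long_enough N L'"
  unfolding long_enough_def
proof (intro allI impI)
  fix \<rho> :: "bool list"
  assume "length \<rho> = L'"
  then obtain X where "pre X L' = \<rho>"
    using pre_surj by blast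
  moreover have "N \<le> length (h (pre X L))"
    using assms(1) by (simp add: long_enough_def)
  ultimately show "N \<le> length (h \<rho>)"
    using h_pre_mono[OF assms(2), of X] by simp
qed

text \<open>Otherwise inputs with short approximations at every length would cluster at some W. A
  prefix of W already yields N output bits, and by monotonicity so does every longer prefix of a
  nearby input.\<close>

lemma ex_long_enough: "\<exists>L. long_enough N L"
proof (rule ccontr)
  assume "\<not> ?thesis"
  then have "\<forall>L. \<exists>X. length (h (pre X L)) < N"
    unfolding long_enough_def by (metis pre_surj not_le)
  then obtain Z where Z: "\<And>L. length (h (pre (Z L) L)) < N"
    by metis
  obtain W where W: "\<And>k n0. \<exists>n\<ge>n0. \<forall>i<k. Z n i = W i"
    using cluster_sequence[of Z] by blast
  obtain k where k: "N \<le> length (h (pre W k))"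
    using h_unbounded by blast
  obtain n where "n \<ge> k" "pre (Z n) k = pre W k"
    using W[of k k] by (auto simp: pre_eq_iff)
  then show False
    using h_pre_mono[of k n "Z n"] Z[of n] k by simp
qed

text \<open>Pairs of inputs that differ within l bits but have images agreeing for N bits, one pair
  for each N, cluster at a pair that still differs within l bits. By continuity its images coincide,
  against injectivity.\<close>

lemma ex_resolves:
  assumes "inj \<Phi>" shows "\<exists>N. resolves N l"
proof (rule ccontr)
  assume "\<not> ?thesis"
  \<comment> \<open>Each counterexample pair is stored as one sequence over
    \<open>bool \<times> bool\<close>, so that both components converge along the same
    indices.\<close>
  then have "\<forall>N. \<exists>Z. pre (fst \<circ> Z) l \<noteq> pre (snd \<circ> Z) l
      \<and> pre (\<Phi> (fst \<circ> Z)) N = pre (\<Phi> (snd \<circ> Z)) N"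
    (is "\<forall>N. \<exists>Z. ?P N Z")
  proof (intro allI)
    fix N
    obtain X Y where "pre X l \<noteq> pre Y l" "pre (\<Phi> X) N = pre (\<Phi> Y) N"
      using \<open>\<not> (\<exists>N. resolves N l)\<close> unfolding resolves_def by blast
    then show "\<exists>Z. ?P N Z"
      by (intro exI[of _ "\<lambda>i. (X i, Y i)"]) (simp add: o_def)
  qed
  then obtain Z where Z: "\<And>N. ?P N (Z N)"
    by metis
  obtain W where W: "\<And>k n0. \<exists>n\<ge>n0. \<forall>i<k. Z n i = W i"
    using cluster_sequence[of Z] by blast
  have "\<Phi> (fst \<circ> W) i = \<Phi> (snd \<circ> W) i" for i
  proof -
    obtain k1 k2 where k: "Suc i \<le> length (h (pre (fst \<circ> W) k1))"
      "Suc i \<le> length (h (pre (snd \<circ> W) k2))"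
      using h_unbounded by blast
    \<comment> \<open>Agreement with W up to k1 and k2 fixes bit i of both limit images;
      \<open>n \<ge> Suc i\<close> makes the two images of the n-th pair agree at that bit.\<close>
    obtain n where n: "n \<ge> Suc i" "\<forall>j<max k1 k2. Z n j = W j"
      using W by blast
    have "pre (fst \<circ> Z n) k1 = pre (fst \<circ> W) k1" "pre (snd \<circ> Z n) k2 = pre (snd \<circ> W) k2"
      using n(2) by (auto simp: pre_eq_iff)
    then have "pre (\<Phi> (fst \<circ> W)) (Suc i) = pre (\<Phi> (fst \<circ> Z n)) (Suc i)"
      "pre (\<Phi> (snd \<circ> W)) (Suc i) = pre (\<Phi> (snd \<circ> Z n)) (Suc i)"
      using k pre_Phi by metis+
    moreover have "pre (\<Phi> (fst \<circ> Z n)) (Suc i) = pre (\<Phi> (snd \<circ> Z n)) (Suc i)"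
      using Z[of n] n(1) by (metis take_pre)
    ultimately show ?thesis
      by (simp add: pre_eq_iff)
  qed
  then have "fst \<circ> W = snd \<circ> W"
    using assms by (simp add: inj_def ext)
  moreover obtain n where "\<forall>i<l. Z n i = W i"
    using W by blast
  then have "pre (fst \<circ> Z n) l = pre (fst \<circ> W) l" "pre (snd \<circ> Z n) l = pre (snd \<circ> W) l"
    by (auto simp: pre_eq_iff)
  ultimately show False
    using Z[of n] by simp
qed

lemma resolves_mono:
  assumes "resolves N l" "N \<le> N'" shows "resolves N' l"
  unfolding resolves_def
proof (intro allI impI)
  fix X Y
  assume "pre X l \<noteq> pre Y l"
  then have "pre (\<Phi> X) N \<noteq> pre (\<Phi> Y) N"
    using assms(1) by (simp add: resolves_def)
  then obtain i where "i < N" "\<Phi> X i \<noteq> \<Phi> Y i"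
    by (auto simp: pre_eq_iff)
  then show "pre (\<Phi> X) N' \<noteq> pre (\<Phi> Y) N'"
    using assms(2) unfolding pre_eq_iff by (meson less_le_trans)
qed

lemma resolves_if_string_resolves:
  assumes "string_resolves N L l" shows "resolves N l"
  unfolding resolves_def
proof (intro allI impI)
  fix X Y
  assume "pre X l \<noteq> pre Y l"
  moreover have "take l (pre X L) = pre X l" "take l (pre Y L) = pre Y l"
    using assms by (simp_all add: string_resolves_def)
  ultimately have "take N (h (pre X L)) \<noteq> take N (h (pre Y L))"
    using assms unfolding string_resolves_def by (metis length_pre)
  moreover have "N \<le> length (h (pre X L))" "N \<le> length (h (pre Y L))"
    using assms by (simp_all add: string_resolves_def long_enough_def)
  ultimately show "pre (\<Phi> X) N \<noteq> pre (\<Phi> Y) N"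
    by (simp add: pre_Phi)
qed

lemma ex_string_resolves:
  assumes "inj \<Phi>" shows "\<exists>N L. string_resolves N L l"
proof -
  obtain N where N: "resolves N l"
    using ex_resolves[OF assms] by blast
  obtain L0 where "long_enough N L0"
    using ex_long_enough by blast
  then have L: "long_enough N (max l L0)" (is "long_enough N ?L")
    by (rule long_enough_mono) simp
  have "take N (h \<rho>) \<noteq> take N (h \<rho>')"
    if \<rho>: "length \<rho> = ?L" "length \<rho>' = ?L" "take l \<rho> \<noteq> take l \<rho>'" for \<rho> \<rho>'
  proof -
    obtain X Y where XY: "pre X ?L = \<rho>" "pre Y ?L = \<rho>'"
      using pre_surj \<rho> by blast
    then have "pre X l \<noteq> pre Y l"
      using \<rho>(3) by (metis take_pre max.cobounded1)
    then have "pre (\<Phi> X) N \<noteq> pre (\<Phi> Y) N"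
      using N by (simp add: resolves_def)
    then show ?thesis
      using L XY \<rho> pre_Phi[of N X ?L] pre_Phi[of N Y ?L] by (simp add: long_enough_def)
  qed
  then show ?thesis
    using L unfolding string_resolves_def by (intro exI[of _ N] exI[of _ ?L]) simp
qed

section \<open>Joint measure of input and output cylinders\<close>

definition cylinders :: "bool list \<Rightarrow> bool list \<Rightarrow> nat \<Rightarrow> bool list set" where
  "cylinders \<sigma> \<tau> L = {\<rho>. length \<rho> = L \<and> take (length \<sigma>) \<rho> = \<sigma> \<and> take (length \<tau>) (h \<rho>) = \<tau>}"

lemma finite_cylinders [simp]: "finite (cylinders \<sigma> \<tau> L)"
  unfolding cylinders_def by (rule finite_subset[OF _ finite_strings[of L]]) blast

text \<open>The first L input bits decide membership on either side. Thus the set is clopen, which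
  gives both its measurability and its dyadic measure.\<close>

lemma cyl_vimage_eq:
  assumes "length \<sigma> \<le> L" "long_enough (length \<tau>) L"
  shows "cyl \<sigma> \<inter> \<Phi> -` cyl \<tau> = (\<Union>\<rho>\<in>cylinders \<sigma> \<tau> L. cyl \<rho>)"
proof -
  have "X \<in> cyl \<sigma> \<inter> \<Phi> -` cyl \<tau> \<longleftrightarrow> pre X L \<in> cylinders \<sigma> \<tau> L" for X
    using assms pre_Phi[of "length \<tau>" X L]
    by (simp add: cyl_def cylinders_def long_enough_def)
  moreover have "X \<in> (\<Union>\<rho>\<in>cylinders \<sigma> \<tau> L. cyl \<rho>) \<longleftrightarrow> pre X L \<in> cylinders \<sigma> \<tau> L" for X
    by (auto simp: cyl_def cylinders_def)
  ultimately show ?thesis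
    by blast
qed

lemma cyl_vimage_measurable: "cyl \<sigma> \<inter> \<Phi> -` cyl \<tau> \<in> sets mu"
proof -
  obtain L where "long_enough (length \<tau>) L"
    using ex_long_enough by blast
  then have "long_enough (length \<tau>) (max (length \<sigma>) L)"
    by (rule long_enough_mono) simp
  then show ?thesis
    by (subst cyl_vimage_eq[of \<sigma> "max (length \<sigma>) L"]) auto
qed

definition joint :: "bool list \<Rightarrow> bool list \<Rightarrow> real" where
  "joint \<sigma> \<tau> = measure mu (cyl \<sigma> \<inter> \<Phi> -` cyl \<tau>)"

lemma joint_nonneg: "0 \<le> joint \<sigma> \<tau>"
  by (simp add: joint_def)

lemma joint_eq_card:
  assumes "length \<sigma> \<le> L" "long_enough (length \<tau>) L"
  shows "joint \<sigma> \<tau> = card (cylinders \<sigma> \<tau> L) / 2 ^ L"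
proof -
  have "joint \<sigma> \<tau> = (\<Sum>\<rho>\<in>cylinders \<sigma> \<tau> L. measure mu (cyl \<rho>))"
    unfolding joint_def cyl_vimage_eq[OF assms]
    by (intro mu.finite_measure_finite_Union)
      (auto simp: disjoint_family_on_def cylinders_def intro!: cyl_disjoint)
  also have "\<dots> = (\<Sum>\<rho>\<in>cylinders \<sigma> \<tau> L. 1 / 2 ^ L)"
    by (intro sum.cong) (auto simp: measure_cyl cylinders_def)
  finally show ?thesis
    by simp
qed

lemma joint_split_left: "joint \<sigma> \<tau> = joint (\<sigma> @ [False]) \<tau> + joint (\<sigma> @ [True]) \<tau>"
proof -
  have "cyl \<sigma> \<inter> \<Phi> -` cyl \<tau>
      = (cyl (\<sigma> @ [False]) \<inter> \<Phi> -` cyl \<tau>) \<union> (cyl (\<sigma> @ [True]) \<inter> \<Phi> -` cyl \<tau>)"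
    using cyl_append[of \<sigma>] by blast
  then show ?thesis
    unfolding joint_def using cyl_append_disjoint[of \<sigma>]
    by (simp only:) (intro mu.finite_measure_Union cyl_vimage_measurable; blast)
qed

lemma joint_split_right: "joint \<sigma> \<tau> = joint \<sigma> (\<tau> @ [False]) + joint \<sigma> (\<tau> @ [True])"
proof -
  have "cyl \<sigma> \<inter> \<Phi> -` cyl \<tau>
      = (cyl \<sigma> \<inter> \<Phi> -` cyl (\<tau> @ [False])) \<union> (cyl \<sigma> \<inter> \<Phi> -` cyl (\<tau> @ [True]))"
    using cyl_append[of \<tau>] by blast
  then show ?thesis
    unfolding joint_def using cyl_append_disjoint[of \<tau>]
    by (simp only:) (intro mu.finite_measure_Union cyl_vimage_measurable; blast)
qed

lemma sum_joint: "(\<Sum>\<tau> | length \<tau> = N. joint \<sigma> \<tau>) = 1 / 2 ^ length \<sigma>"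
proof -
  have "(\<Sum>\<tau> | length \<tau> = N. joint \<sigma> \<tau>)
      = measure mu (\<Union>\<tau>\<in>{\<tau>. length \<tau> = N}. cyl \<sigma> \<inter> \<Phi> -` cyl \<tau>)"
    unfolding joint_def
  proof (intro mu.finite_measure_finite_Union[symmetric])
    show "disjoint_family_on (\<lambda>\<tau>. cyl \<sigma> \<inter> \<Phi> -` cyl \<tau>) {\<tau>. length \<tau> = N}"
      unfolding disjoint_family_on_def using cyl_disjoint by blast
  qed (auto intro: cyl_vimage_measurable)
  also have "(\<Union>\<tau>\<in>{\<tau>. length \<tau> = N}. cyl \<sigma> \<inter> \<Phi> -` cyl \<tau>) = cyl \<sigma>"
    by (auto simp: cyl_def)
  finally show ?thesis
    by (simp add: measure_cyl)
qed

text \<open>Positive measure is only needed to find one common point X. Any other input mapped into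
  \<open>cyl \<tau>\<close> shares the output prefix with X, hence also the first
  \<open>length \<sigma>\<close> input bits.\<close>

lemma joint_resolved:
  assumes "resolves (length \<tau>) (length \<sigma>)" "joint \<sigma> \<tau> \<noteq> 0"
  shows "cyl \<sigma> \<inter> \<Phi> -` cyl \<tau> = \<Phi> -` cyl \<tau>"
proof -
  have "cyl \<sigma> \<inter> \<Phi> -` cyl \<tau> \<noteq> {}"
    using assms(2) by (intro notI) (simp add: joint_def)
  then obtain X where X: "pre X (length \<sigma>) = \<sigma>" "pre (\<Phi> X) (length \<tau>) = \<tau>"
    by (auto simp: cyl_def)
  have "Y \<in> cyl \<sigma>" if "\<Phi> Y \<in> cyl \<tau>" for Y
  proof -
    have "pre (\<Phi> Y) (length \<tau>) = pre (\<Phi> X) (length \<tau>)"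
      using that X by (simp add: cyl_def)
    then have "pre Y (length \<sigma>) = pre X (length \<sigma>)"
      using assms(1) unfolding resolves_def by blast
    then show ?thesis
      using X by (simp add: cyl_def)
  qed
  then show ?thesis
    by auto
qed

subsection \<open>Pulling back martingales\<close>

text \<open>This is the integral of \<open>f (pre (\<Phi> X) N)\<close> over X in
  \<open>cyl \<sigma>\<close>.\<close>

definition pullback :: "(bool list \<Rightarrow> real) \<Rightarrow> bool list \<Rightarrow> nat \<Rightarrow> real" where
  "pullback f \<sigma> N = (\<Sum>\<tau> | length \<tau> = N. f \<tau> * joint \<sigma> \<tau>)"

lemma pullback_split:
  "pullback f \<sigma> N = pullback f (\<sigma> @ [False]) N + pullback f (\<sigma> @ [True]) N"
  unfolding pullback_def sum.distrib[symmetric]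
  by (intro sum.cong refl) (simp only: joint_split_left[of \<sigma>] distrib_left)

text \<open>Fairness of f concerns whole preimages of cylinders, not their parts inside
  \<open>cyl \<sigma>\<close>. Resolution removes the difference: each \<tau> contributes 0, as do
  both its extensions, or its preimage lies entirely in \<open>cyl \<sigma>\<close>.\<close>

lemma pullback_Suc:
  assumes f: "phi_martingale \<Phi> f" and N: "resolves N (length \<sigma>)"
  shows "pullback f \<sigma> (Suc N) = pullback f \<sigma> N"
proof -
  have "pullback f \<sigma> (Suc N) = (\<Sum>\<tau> | length \<tau> = N.
      f (\<tau> @ [False]) * joint \<sigma> (\<tau> @ [False]) + f (\<tau> @ [True]) * joint \<sigma> (\<tau> @ [True]))"
    unfolding pullback_def strings_Suc
    by (subst sum.union_disjoint) (auto simp: sum.distrib sum.reindex inj_on_def)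
  also have "\<dots> = pullback f \<sigma> N"
    unfolding pullback_def
  proof (rule sum.cong[OF refl])
    fix \<tau> :: "bool list"
    assume "\<tau> \<in> {\<tau>. length \<tau> = N}"
    then have res: "resolves (length \<tau>) (length \<sigma>)"
      using N by simp
    show "f (\<tau> @ [False]) * joint \<sigma> (\<tau> @ [False]) + f (\<tau> @ [True]) * joint \<sigma> (\<tau> @ [True])
        = f \<tau> * joint \<sigma> \<tau>"
    proof (cases "joint \<sigma> \<tau> = 0")
      case True
      then have "joint \<sigma> (\<tau> @ [False]) = 0" "joint \<sigma> (\<tau> @ [True]) = 0"
        using joint_split_right[of \<sigma> \<tau>] joint_nonneg[of \<sigma> "\<tau> @ [False]"]
          joint_nonneg[of \<sigma> "\<tau> @ [True]"] by linarith+
      with True show ?thesis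
        by simp
    next
      case False
      then have "\<Phi> -` cyl \<tau> \<subseteq> cyl \<sigma>"
        using joint_resolved[OF res] by blast
      then have "cyl \<sigma> \<inter> \<Phi> -` cyl \<tau> = \<Phi> -` cyl \<tau>"
        "\<And>b. cyl \<sigma> \<inter> \<Phi> -` cyl (\<tau> @ [b]) = \<Phi> -` cyl (\<tau> @ [b])"
        using in_cyl_snoc by blast+
      then show ?thesis
        using f[unfolded phi_martingale_def, THEN conjunct2, rule_format, of \<tau>]
        by (simp add: pushmeas_def joint_def)
    qed
  qed
  finally show ?thesis .
qed

lemma pullback_resolved:
  assumes "phi_martingale \<Phi> f" "resolves N (length \<sigma>)" "N \<le> N'"
  shows "pullback f \<sigma> N' = pullback f \<sigma> N"
  using assms(3)
proof (induction N' rule: dec_induct)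
  case (step N')
  then show ?case
    using pullback_Suc[OF assms(1)] resolves_mono[OF assms(2)] by simp
qed simp

text \<open>The weights \<open>joint \<sigma> \<tau>\<close> add up to
  \<open>1 / 2 ^ length \<sigma>\<close>, and outputs not reached from \<open>cyl \<sigma>\<close>
  have weight 0, so no bound on f is required there.\<close>

lemma pullback_ge:
  assumes "\<And>X. X \<in> cyl \<sigma> \<Longrightarrow> K \<le> f (pre (\<Phi> X) N)"
  shows "K / 2 ^ length \<sigma> \<le> pullback f \<sigma> N"
proof -
  have "K * joint \<sigma> \<tau> \<le> f \<tau> * joint \<sigma> \<tau>" if \<tau>: "length \<tau> = N" for \<tau>
  proof (cases "joint \<sigma> \<tau> = 0")
    case False
    then have "cyl \<sigma> \<inter> \<Phi> -` cyl \<tau> \<noteq> {}"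
      by (intro notI) (simp add: joint_def)
    then obtain X where "X \<in> cyl \<sigma>" "pre (\<Phi> X) N = \<tau>"
      using \<tau> by (auto simp: cyl_def)
    then show ?thesis
      using assms joint_nonneg by (intro mult_right_mono) auto
  qed simp
  then have "(\<Sum>\<tau> | length \<tau> = N. K * joint \<sigma> \<tau>) \<le> pullback f \<sigma> N"
    unfolding pullback_def by (intro sum_mono) auto
  then show ?thesis
    by (simp add: sum_joint flip: sum_distrib_left)
qed

text \<open>Grouping the strings \<rho> by the first N bits of \<open>h \<rho>\<close> absorbs every
  \<open>joint\<close> into a count. Only finitely many values of f remain to be
  approximated.\<close>

lemma pullback_eq_average:
  assumes "length \<sigma> \<le> L" "long_enough N L"
  shows "pullback f \<sigma> N
    = (\<Sum>\<rho> | length \<rho> = L. if take (length \<sigma>) \<rho> = \<sigma> then f (take N (h \<rho>)) else 0) / 2 ^ L"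
proof -
  have "pullback f \<sigma> N = (\<Sum>\<tau> | length \<tau> = N. f \<tau> * card (cylinders \<sigma> \<tau> L)) / 2 ^ L"
    unfolding pullback_def sum_divide_distrib
    by (intro sum.cong) (simp_all add: joint_eq_card[of \<sigma> L] assms)
  also have "(\<Sum>\<tau> | length \<tau> = N. f \<tau> * card (cylinders \<sigma> \<tau> L))
      = (\<Sum>\<tau> | length \<tau> = N. \<Sum>\<rho>\<in>cylinders \<sigma> \<tau> L. f (take N (h \<rho>)))"
    by (intro sum.cong) (auto simp: cylinders_def)
  also have "\<dots> = (\<Sum>\<rho>\<in>(\<Union>\<tau>\<in>{\<tau>. length \<tau> = N}. cylinders \<sigma> \<tau> L). f (take N (h \<rho>)))"
    by (intro sum.UNION_disjoint[symmetric]) (auto simp: cylinders_def)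
  also have "(\<Union>\<tau>\<in>{\<tau>. length \<tau> = N}. cylinders \<sigma> \<tau> L)
      = {\<rho> \<in> {\<rho>. length \<rho> = L}. take (length \<sigma>) \<rho> = \<sigma>}"
    using assms(2) by (auto simp: cylinders_def long_enough_def)
  finally show ?thesis
    by (simp only: sum.inter_filter[OF finite_strings])
qed

end

section \<open>Saving part of the capital\<close>

text \<open>Of the original stake, the fraction \<open>2 ^ -level\<close> is still active. Whenever the estimate B of b
  guarantees an active capital of at least 1, half of it is put aside for good. Since B is
  integer-valued, this decision is decidable although b has real values.\<close>

fun level :: "(bool list \<Rightarrow> nat) \<Rightarrow> bool list \<Rightarrow> nat \<Rightarrow> nat" where
  "level B \<tau> 0 = 0"
| "level B \<tau> (Suc k) =
    (if 2 ^ level B \<tau> k + 2 \<le> B (take k \<tau>) then Suc (level B \<tau> k) else level B \<tau> k)"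

text \<open>Each summand is half of the active capital
  \<open>b (take k \<tau>) / 2 ^ level B \<tau> k\<close> at the moment of a withdrawal.\<close>

definition saved :: "(bool list \<Rightarrow> real) \<Rightarrow> (bool list \<Rightarrow> nat) \<Rightarrow> bool list \<Rightarrow> nat \<Rightarrow> real" where
  "saved b B \<tau> n = (\<Sum>k<n. if level B \<tau> k < level B \<tau> (Suc k)
    then b (take k \<tau>) / 2 ^ level B \<tau> (Suc k) else 0)"

definition saving :: "(bool list \<Rightarrow> real) \<Rightarrow> (bool list \<Rightarrow> nat) \<Rightarrow> bool list \<Rightarrow> real" where
  "saving b B \<tau> = saved b B \<tau> (length \<tau>) + b \<tau> / 2 ^ level B \<tau> (length \<tau>)"

text \<open>Step k consults only the prefix of length k. Thus the level at stage
  \<open>Suc (length \<tau>)\<close> is already fixed by \<tau> and is common to both one-bit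
  extensions.\<close>

lemma level_cong:
  assumes "\<And>k. k < n \<Longrightarrow> take k \<tau> = take k \<tau>'" shows "level B \<tau> n = level B \<tau>' n"
  using assms by (induction n) auto

lemma saved_cong:
  assumes "\<And>k. k < n \<Longrightarrow> take k \<tau> = take k \<tau>'" shows "saved b B \<tau> n = saved b B \<tau>' n"
  unfolding saved_def
proof (intro sum.cong refl)
  fix k
  assume k: "k \<in> {..<n}"
  have "level B \<tau> k = level B \<tau>' k" "level B \<tau> (Suc k) = level B \<tau>' (Suc k)"
    using k by (intro level_cong; auto intro: assms)+
  moreover have "take k \<tau> = take k \<tau>'"
    using k assms by simp
  ultimately show "(if level B \<tau> k < level B \<tau> (Suc k)
        then b (take k \<tau>) / 2 ^ level B \<tau> (Suc k) else 0)
      = (if level B \<tau>' k < level B \<tau>' (Suc k) then b (take k \<tau>') / 2 ^ level B \<tau>' (Suc k) else 0)"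
    by (simp only:)
qed

lemma level_mono: "m \<le> n \<Longrightarrow> level B \<tau> m \<le> level B \<tau> n"
  by (rule lift_Suc_mono_le) auto

lemma saving_snoc:
  "saving b B (\<tau> @ [c]) = saved b B \<tau> (Suc (length \<tau>))
    + b (\<tau> @ [c]) / 2 ^ level B \<tau> (Suc (length \<tau>))"
proof -
  have t: "take k (\<tau> @ [c]) = take k \<tau>" if "k < Suc (length \<tau>)" for k
    using that by simp
  show ?thesis
    unfolding saving_def length_append_singleton
    by (simp only: level_cong[OF t] saved_cong[OF t])
qed

text \<open>Moving half of the active capital into savings leaves the total unchanged. The parent
  can therefore be written with the same saved amount and level as its children in
  \<open>saving_snoc\<close>.\<close>

lemma saving_eq:
  "saving b B \<tau> = saved b B \<tau> (Suc (length \<tau>)) + b \<tau> / 2 ^ level B \<tau> (Suc (length \<tau>))"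
  by (simp add: saving_def saved_def)

text \<open>Over one step the saving function is a constant plus a fixed multiple of b. The constant
  is fair because \<open>pushmeas\<close> is additive, the multiple because b is fair.\<close>

lemma phi_martingale_saving:
  assumes b: "phi_martingale \<Phi> b"
    and push: "\<And>\<tau>. pushmeas \<Phi> \<tau> = pushmeas \<Phi> (\<tau> @ [False]) + pushmeas \<Phi> (\<tau> @ [True])"
  shows "phi_martingale \<Phi> (saving b B)"
proof -
  have nonneg: "0 \<le> b \<tau>" for \<tau>
    using b by (simp add: phi_martingale_def)
  have "saving b B \<tau> * pushmeas \<Phi> \<tau> = saving b B (\<tau> @ [False]) * pushmeas \<Phi> (\<tau> @ [False])
      + saving b B (\<tau> @ [True]) * pushmeas \<Phi> (\<tau> @ [True])" for \<tau>
  proof -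
    have lin: "(s + x / d) * p = (s + y / d) * q + (s + z / d) * r"
      if "x * p = y * q + z * r" "p = q + r" for s d x y z p q r :: real
    proof -
      have "x / d * p = y / d * q + z / d * r"
        using arg_cong[OF that(1), of "\<lambda>u. u / d"] by (simp add: add_divide_distrib)
      then show ?thesis
        using that(2) by (simp add: distrib_left distrib_right)
    qed
    show ?thesis
      unfolding saving_snoc saving_eq[of b B \<tau>]
      using b[unfolded phi_martingale_def] push by (intro lin) blast+
  qed
  moreover have "0 \<le> saving b B \<tau>" for \<tau>
    unfolding saving_def saved_def using nonneg by (intro add_nonneg_nonneg sum_nonneg) auto
  ultimately show ?thesis
    unfolding phi_martingale_def by blast
qed

lemma saved_ge:
  assumes "\<And>\<tau>. \<bar>b \<tau> - real (B \<tau>)\<bar> \<le> 2"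
  shows "real (level B \<tau> n) / 2 \<le> saved b B \<tau> n"
proof (induction n)
  case 0
  then show ?case
    by (simp add: saved_def)
next
  case (Suc n)
  show ?case
  proof (cases "2 ^ level B \<tau> n + 2 \<le> B (take n \<tau>)")
    case True
    then have "real (2 ^ level B \<tau> n + 2) \<le> real (B (take n \<tau>))"
      by (simp only: of_nat_le_iff)
    \<comment> \<open>The 2 in the withdrawal threshold pays for the error of B, so the active
      capital is at least 1 and each withdrawal saves at least 1/2.\<close>
    then have "2 ^ level B \<tau> n \<le> b (take n \<tau>)"
      using assms[of "take n \<tau>"] by simp
    then have "1 / 2 \<le> b (take n \<tau>) / 2 ^ Suc (level B \<tau> n)"
      by (simp add: field_simps)
    moreover have "real (level B \<tau> (Suc n)) = real (level B \<tau> n) + 1"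
      "saved b B \<tau> (Suc n) = saved b B \<tau> n + b (take n \<tau>) / 2 ^ Suc (level B \<tau> n)"
      using True by (simp_all add: saved_def)
    ultimately show ?thesis
      using Suc by linarith
  next
    case False
    then show ?thesis
      using Suc by (simp add: saved_def)
  qed
qed

text \<open>Savings never shrink, so a level reached at stage n bounds the capital at every later
  stage, whatever b does afterwards.\<close>

lemma saving_ge_level:
  assumes "\<And>\<tau>. \<bar>b \<tau> - real (B \<tau>)\<bar> \<le> 2" "\<And>\<tau>. 0 \<le> b \<tau>" "n \<le> length \<tau>"
  shows "real (level B \<tau> n) / 2 \<le> saving b B \<tau>"
proof -
  have "real (level B \<tau> n) / 2 \<le> real (level B \<tau> (length \<tau>)) / 2"
    using level_mono[OF assms(3)] by simp
  also have "\<dots> \<le> saved b B \<tau> (length \<tau>)"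
    using assms(1) by (rule saved_ge)
  also have "\<dots> \<le> saving b B \<tau>"
    using assms(2) by (simp add: saving_def)
  finally show ?thesis .
qed

lemma succeeds_unbounded:
  assumes "succeeds b Y" shows "\<exists>n\<ge>m. C \<le> b (pre Y n)"
proof (rule ccontr)
  assume "\<not> ?thesis"
  then have "b (pre Y n) \<le> C" if "m \<le> n" for n
    using that by (meson linear)
  then have "eventually (\<lambda>n. ereal (b (pre Y n)) \<le> ereal C) sequentially"
    by (intro eventually_sequentiallyI[of m]) simp
  then have "limsup (\<lambda>n. ereal (b (pre Y n))) \<le> ereal C"
    by (rule Limsup_bounded)
  then show False
    using assms by (simp add: succeeds_def)
qed

lemma level_unbounded:
  assumes approx: "\<And>\<tau>. \<bar>b \<tau> - real (B \<tau>)\<bar> \<le> 2" and "succeeds b Y"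
  shows "\<exists>n. K \<le> level B (pre Y n) n"
proof (induction K)
  case (Suc K)
  then obtain m where m: "K \<le> level B (pre Y m) m"
    by blast
  \<comment> \<open>The 4 is the 2 in the withdrawal threshold plus the error 2 of B: if the level
    is still K at stage n, a withdrawal occurs there.\<close>
  obtain n where n: "m \<le> n" "2 ^ K + 4 \<le> b (pre Y n)"
    using succeeds_unbounded[OF assms(2)] by blast
  have "level B (pre Y m) m = level B (pre Y (Suc n)) m"
    using n(1) by (intro level_cong) simp
  also have "\<dots> \<le> level B (pre Y (Suc n)) n"
    using n(1) by (rule level_mono)
  finally have K: "K \<le> level B (pre Y (Suc n)) n"
    using m by simp
  show ?case
  proof (cases "K = level B (pre Y (Suc n)) n")
    case True
    have "real (2 ^ K + 2) \<le> real (B (pre Y n))"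
      using n(2) approx[of "pre Y n"] by simp
    then have "2 ^ K + 2 \<le> B (pre Y n)"
      by (simp only: of_nat_le_iff)
    then have "Suc K \<le> level B (pre Y (Suc n)) (Suc n)"
      using True by simp
    then show ?thesis
      by blast
  next
    case False
    then have "Suc K \<le> level B (pre Y (Suc n)) (Suc n)"
      using K level_mono[of n "Suc n" B "pre Y (Suc n)"] by linarith
    then show ?thesis
      by blast
  qed
qed simp

section \<open>Approximating the saving martingale\<close>

text \<open>The rational coded by q, times \<open>2 ^ p\<close>, rounded down, with negative
  rationals replaced by 0. \<open>int_decode\<close> maps exactly the even codes to nonnegative
  integers.\<close>

definition scaled :: "nat \<Rightarrow> nat \<Rightarrow> nat" where
  "scaled q p = (if fst (prod_decode q) mod 2 = 0
    then fst (prod_decode q) div 2 * 2 ^ p div Suc (snd (prod_decode q)) else 0)"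

lemma real_div_bounds:
  assumes "0 < d"
  shows "real (n div d) \<le> real n / real d" "real n / real d < real (n div d) + 1"
proof -
  show "real (n div d) \<le> real n / real d"
    by (rule of_nat_div_le_of_nat)
  have "real n = real d * real (n div d) + real (n mod d)"
    by (simp flip: of_nat_mult of_nat_add)
  moreover have "real (n mod d) < real d"
    using assms by simp
  ultimately show "real n / real d < real (n div d) + 1"
    using assms by (simp add: field_simps)
qed

text \<open>The approximation and the rounding each cost at most 1; replacing a negative rational by
  0 costs nothing more because x is nonnegative.\<close>

lemma scaled_approx:
  assumes "0 \<le> x" "\<bar>x - rat_of_code q\<bar> \<le> 1 / 2 ^ p"
  shows "\<bar>x * 2 ^ p - real (scaled q p)\<bar> \<le> 2"
proof -
  obtain a d where q: "prod_decode q = (a, d)"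
    by force
  have "\<bar>x - rat_of_code q\<bar> * 2 ^ p \<le> 1 / 2 ^ p * 2 ^ p"
    using assms(2) by (intro mult_right_mono) auto
  then have x: "\<bar>x * 2 ^ p - rat_of_code q * 2 ^ p\<bar> \<le> 1"
    by (simp add: abs_mult flip: left_diff_distrib)
  show ?thesis
  proof (cases "even a")
    case True
    then have "rat_of_code q * 2 ^ p = real (a div 2 * 2 ^ p) / real (Suc d)"
      by (simp add: rat_of_code_def q int_decode_def sum_decode_def)
    moreover have "scaled q p = a div 2 * 2 ^ p div Suc d"
      using True by (simp add: scaled_def q even_iff_mod_2_eq_zero)
    ultimately show ?thesis
      using x real_div_bounds[of "Suc d" "a div 2 * 2 ^ p"] by linarith
  next
    case False
    then have "rat_of_code q \<le> 0"
      by (simp add: rat_of_code_def q int_decode_def sum_decode_def divide_nonpos_pos)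
    then have "rat_of_code q * 2 ^ p \<le> 0"
      by (simp add: mult_nonpos_nonneg)
    moreover have "scaled q p = 0"
      using False by (simp add: scaled_def q even_iff_mod_2_eq_zero)
    moreover have "0 \<le> x * 2 ^ p"
      using assms(1) by simp
    ultimately show ?thesis
      using x by linarith
  qed
qed

lemma recursive_scaled [rec_intros]:
  assumes "recursive k a" "recursive k b" shows "recursive k (\<lambda>xs. scaled (a xs) (b xs))"
  unfolding scaled_def by (intro rec_intros assms)

text \<open>Prefixes of a string are computed on the code e of the string, increased by one: the prefix of
  length k has the increased code \<open>2 ^ k + e mod 2 ^ k\<close>.\<close>

definition code_estimate :: "(nat \<Rightarrow> nat \<Rightarrow> nat) \<Rightarrow> nat \<Rightarrow> nat \<Rightarrow> nat \<Rightarrow> nat" where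
  "code_estimate g e k p = scaled (g (2 ^ k + e mod 2 ^ k - 1) p) p"

text \<open>Withdrawals are always decided at precision 0. They are part of the martingale itself,
  so they must not change with the accuracy p requested for its values.\<close>

definition code_level :: "(nat \<Rightarrow> nat \<Rightarrow> nat) \<Rightarrow> nat \<Rightarrow> nat \<Rightarrow> nat" where
  "code_level g e n =
    rec_nat 0 (\<lambda>k z. if 2 ^ z + 2 \<le> code_estimate g e k 0 then Suc z else z) n"

definition code_saving :: "(nat \<Rightarrow> nat \<Rightarrow> nat) \<Rightarrow> nat \<Rightarrow> nat \<Rightarrow> nat \<Rightarrow> nat" where
  "code_saving g e n p =
    (\<Sum>k<n. if code_level g e k < code_level g e (Suc k)
      then code_estimate g e k p div 2 ^ code_level g e (Suc k) else 0)
    + code_estimate g e n p div 2 ^ code_level g e n"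

lemma recursive_code_estimate [rec_intros]:
  assumes g: "computable2 g" and "recursive k a" "recursive k b" "recursive k c"
  shows "recursive k (\<lambda>xs. code_estimate g (a xs) (b xs) (c xs))"
  unfolding code_estimate_def
  by (intro rec_intros assms recursive_comp2[OF recursive_computable2[OF g]])

lemma recursive_code_level [rec_intros]:
  assumes g: "computable2 g" and "recursive k a" "recursive k b"
  shows "recursive k (\<lambda>xs. code_level g (a xs) (b xs))"
proof (rule recursive_comp2[OF _ assms(2,3)])
  show "recursive 2 (\<lambda>xs. code_level g (hd xs) (hd (tl xs)))"
    unfolding code_level_def by (intro rec_intros g) auto
qed

lemma recursive_code_saving [rec_intros]:
  assumes g: "computable2 g" and "recursive k a" "recursive k b" "recursive k c"
  shows "recursive k (\<lambda>xs. code_saving g (a xs) (b xs) (c xs))"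
proof (rule recursive_comp3[OF _ assms(2-4)])
  show "recursive 3 (\<lambda>xs. code_saving g (hd xs) (hd (tl xs)) (hd (tl (tl xs))))"
    unfolding code_saving_def by (intro rec_intros g) auto
qed

lemma code_estimate_enc:
  "k \<le> length \<tau> \<Longrightarrow> code_estimate g (Suc (enc \<tau>)) k p = scaled (g (enc (take k \<tau>)) p) p"
  by (simp add: code_estimate_def flip: Suc_enc_take)

lemma code_level_enc:
  "n \<le> Suc (length \<tau>) \<Longrightarrow>
    code_level g (Suc (enc \<tau>)) n = level (\<lambda>\<tau>. scaled (g (enc \<tau>) 0) 0) \<tau> n"
  by (induction n) (simp_all add: code_level_def code_estimate_enc)

lemma div_power_approx:
  fixes x :: real
  assumes "\<bar>x * 2 ^ p - real n\<bar> \<le> 2"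
  shows "\<bar>x / 2 ^ j * 2 ^ p - real (n div 2 ^ j)\<bar> \<le> 3"
proof -
  have "\<bar>x * 2 ^ p - real n\<bar> / 2 ^ j \<le> 2 / 1"
    using assms by (intro frac_le) auto
  then have "\<bar>x / 2 ^ j * 2 ^ p - real n / 2 ^ j\<bar> \<le> 2"
    by (simp add: diff_divide_distrib[symmetric] abs_divide)
  then show ?thesis
    using real_div_bounds[of "2 ^ j" n] by simp
qed

text \<open>There are at most \<open>length \<tau>\<close> withdrawals and one active term. Each has
  error at most 3: 2 from the estimate and 1 from the final integer division.\<close>

lemma code_saving_approx:
  assumes b: "\<And>\<tau>. 0 \<le> b \<tau>" and g: "\<And>\<tau> p. \<bar>b \<tau> - rat_of_code (g (enc \<tau>) p)\<bar> \<le> 1 / 2 ^ p"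
  shows "\<bar>saving b (\<lambda>\<tau>. scaled (g (enc \<tau>) 0) 0) \<tau> * 2 ^ p
      - real (code_saving g (Suc (enc \<tau>)) (length \<tau>) p)\<bar> \<le> 3 * (real (length \<tau>) + 1)"
proof -
  let ?B = "\<lambda>\<tau>. scaled (g (enc \<tau>) 0) 0"
  let ?n = "length \<tau>"
  let ?x = "\<lambda>k. if level ?B \<tau> k < level ?B \<tau> (Suc k)
    then b (take k \<tau>) / 2 ^ level ?B \<tau> (Suc k) * 2 ^ p else 0"
  let ?y = "\<lambda>k. if level ?B \<tau> k < level ?B \<tau> (Suc k)
    then scaled (g (enc (take k \<tau>)) p) p div 2 ^ level ?B \<tau> (Suc k) else 0"
  let ?u = "b \<tau> / 2 ^ level ?B \<tau> ?n * 2 ^ p"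
  let ?v = "scaled (g (enc \<tau>) p) p div 2 ^ level ?B \<tau> ?n"
  have est: "\<bar>b \<rho> / 2 ^ j * 2 ^ p - real (scaled (g (enc \<rho>) p) p div 2 ^ j)\<bar> \<le> 3" for \<rho> j
    using b g by (intro div_power_approx scaled_approx)
  have eq1: "saving b ?B \<tau> * 2 ^ p = (\<Sum>k<?n. ?x k) + ?u"
    unfolding saving_def saved_def distrib_right sum_distrib_right
    by (intro arg_cong2[of _ _ _ _ "(+)"] sum.cong refl) simp
  have eq2: "real (code_saving g (Suc (enc \<tau>)) ?n p) = real (\<Sum>k<?n. ?y k) + real ?v"
    unfolding code_saving_def of_nat_add
    by (intro arg_cong2[of _ _ _ _ "(+)"] arg_cong[of _ _ real] sum.cong refl)
      (simp_all add: code_level_enc code_estimate_enc del: level.simps)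
  have sum: "\<bar>(\<Sum>k<?n. ?x k) - real (\<Sum>k<?n. ?y k)\<bar> \<le> 3 * real ?n"
  proof -
    have "\<bar>?x k - real (?y k)\<bar> \<le> 3" for k
      using est[of "take k \<tau>" "level ?B \<tau> (Suc k)"] by (simp del: level.simps)
    then have "\<bar>\<Sum>k<?n. ?x k - real (?y k)\<bar> \<le> (\<Sum>k<?n. 3)"
      by (intro order_trans[OF sum_abs] sum_mono)
    then show ?thesis
      by (simp only: of_nat_sum sum_subtractf sum_constant card_lessThan mult.commute)
  qed
  have "\<bar>(x + u) - (y + v)\<bar> \<le> 3 * (c + 1)"
    if "\<bar>x - y\<bar> \<le> 3 * c" "\<bar>u - v\<bar> \<le> 3" for x y u v c :: real
    using that unfolding abs_le_iff distrib_left by linarith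
  then show ?thesis
    unfolding eq1 eq2 using sum est by this
qed

section \<open>The pulled back martingale is computable\<close>

locale computable_injection = monotone_approximation +
  fixes H :: "nat \<Rightarrow> nat"
  assumes H_computable: "computable1 H" and H_enc: "H (enc \<sigma>) = enc (h \<sigma>)"
    and inj_Phi: "inj \<Phi>"
begin

lemma pushmeas_split: "pushmeas \<Phi> \<tau> = pushmeas \<Phi> (\<tau> @ [False]) + pushmeas \<Phi> (\<tau> @ [True])"
proof -
  have eq: "pushmeas \<Phi> \<tau> = joint [] \<tau>" for \<tau>
    by (simp add: pushmeas_def joint_def cyl_def pre_def)
  show ?thesis
    unfolding eq by (rule joint_split_right)
qed

section \<open>Searching for sufficient output and input lengths\<close>

definition code_h :: "nat \<Rightarrow> nat" where
  "code_h e = Suc (H (e - 1))"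

lemma code_h_enc: "code_h (Suc (enc \<sigma>)) = Suc (enc (h \<sigma>))"
  by (simp add: code_h_def H_enc)

definition code_resolves :: "nat \<Rightarrow> nat \<Rightarrow> nat \<Rightarrow> bool" where
  "code_resolves N L l \<longleftrightarrow> l \<le> L \<and> (\<forall>r<2 ^ L. 2 ^ N \<le> code_h (2 ^ L + r)) \<and>
    (\<forall>r<2 ^ L. \<forall>r'<2 ^ L. (2 ^ L + r) mod 2 ^ l \<noteq> (2 ^ L + r') mod 2 ^ l \<longrightarrow>
      code_h (2 ^ L + r) mod 2 ^ N \<noteq> code_h (2 ^ L + r') mod 2 ^ N)"

lemma length_ge_iff: "N \<le> length \<sigma> \<longleftrightarrow> 2 ^ N \<le> Suc (enc \<sigma>)"
proof
  assume "N \<le> length \<sigma>"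
  then have "(2 :: nat) ^ N \<le> 2 ^ length \<sigma>"
    by (intro power_increasing) auto
  then show "2 ^ N \<le> Suc (enc \<sigma>)"
    using Suc_enc_bounds[of \<sigma>] by linarith
next
  assume "2 ^ N \<le> Suc (enc \<sigma>)"
  then have "(2 :: nat) ^ N < 2 ^ Suc (length \<sigma>)"
    using Suc_enc_bounds[of \<sigma>] by linarith
  then have "N < Suc (length \<sigma>)"
    by (rule power_less_imp_less_exp[rotated]) simp
  then show "N \<le> length \<sigma>"
    by simp
qed

lemma take_eq_iff:
  assumes "n \<le> length \<sigma>" "n \<le> length \<tau>"
  shows "take n \<sigma> = take n \<tau> \<longleftrightarrow> Suc (enc \<sigma>) mod 2 ^ n = Suc (enc \<tau>) mod 2 ^ n"
proof -
  have "take n \<sigma> = take n \<tau> \<longleftrightarrow> Suc (enc (take n \<sigma>)) = Suc (enc (take n \<tau>))"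
    using enc_inj by auto
  then show ?thesis
    by (simp only: Suc_enc_take assms add_left_cancel)
qed

lemma string_resolves_iff: "string_resolves N L l \<longleftrightarrow> code_resolves N L l"
proof -
  let ?far = "\<lambda>e e'. e mod 2 ^ l \<noteq> e' mod 2 ^ l \<longrightarrow> code_h e mod 2 ^ N \<noteq> code_h e' mod 2 ^ N"
  have long: "long_enough N L \<longleftrightarrow> (\<forall>r<2 ^ L. 2 ^ N \<le> code_h (2 ^ L + r))"
    unfolding long_enough_def length_ge_iff[of N]
    using all_strings_enc[of L "\<lambda>e. 2 ^ N \<le> code_h e"] by (simp only: code_h_enc)
  \<comment> \<open>Residues describe prefixes only of strings that are long enough, so the
    separation condition is translated under the two other conditions.\<close>
  have "(\<forall>\<rho>. length \<rho> = L \<longrightarrow> (\<forall>\<rho>'. length \<rho>' = L \<longrightarrow>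
      take l \<rho> \<noteq> take l \<rho>' \<longrightarrow> take N (h \<rho>) \<noteq> take N (h \<rho>')))
    \<longleftrightarrow> (\<forall>\<rho>. length \<rho> = L \<longrightarrow> (\<forall>\<rho>'. length \<rho>' = L \<longrightarrow> ?far (Suc (enc \<rho>)) (Suc (enc \<rho>'))))"
    if "l \<le> L" "long_enough N L"
  proof -
    have "(take l \<rho> \<noteq> take l \<rho>' \<longrightarrow> take N (h \<rho>) \<noteq> take N (h \<rho>'))
        \<longleftrightarrow> ?far (Suc (enc \<rho>)) (Suc (enc \<rho>'))" if "length \<rho> = L" "length \<rho>' = L" for \<rho> \<rho>'
    proof -
      have "l \<le> length \<rho>" "l \<le> length \<rho>'" "N \<le> length (h \<rho>)" "N \<le> length (h \<rho>')"
        using that \<open>l \<le> L\<close> \<open>long_enough N L\<close> by (simp_all add: long_enough_def)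
      then show ?thesis
        by (simp only: take_eq_iff code_h_enc)
    qed
    then show ?thesis
      by blast
  qed
  also have "(\<forall>\<rho>. length \<rho> = L \<longrightarrow> (\<forall>\<rho>'. length \<rho>' = L \<longrightarrow> ?far (Suc (enc \<rho>)) (Suc (enc \<rho>'))))
      \<longleftrightarrow> (\<forall>\<rho>. length \<rho> = L \<longrightarrow> (\<forall>r'<2 ^ L. ?far (Suc (enc \<rho>)) (2 ^ L + r')))"
    by (intro all_cong1 imp_cong refl all_strings_enc)
  also have "\<dots> \<longleftrightarrow> (\<forall>r<2 ^ L. \<forall>r'<2 ^ L. ?far (2 ^ L + r) (2 ^ L + r'))"
    by (rule all_strings_enc)
  finally show ?thesis
    unfolding string_resolves_def code_resolves_def long[symmetric] by blast
qed

text \<open>N and L are searched together as one coded pair; success is represented by 0 because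
  \<open>Minz\<close> looks for a zero.\<close>

definition resolving :: "nat \<Rightarrow> nat" where
  "resolving l = (LEAST t. (if code_resolves (fst (prod_decode t)) (snd (prod_decode t)) l
    then 0 else 1) = (0 :: nat))"

definition out_length :: "nat \<Rightarrow> nat" where
  "out_length l = fst (prod_decode (resolving l))"

definition in_length :: "nat \<Rightarrow> nat" where
  "in_length l = snd (prod_decode (resolving l))"

lemma ex_resolving:
  "\<exists>t. (if code_resolves (fst (prod_decode t)) (snd (prod_decode t)) l then 0 else 1) = (0 :: nat)"
proof -
  obtain N L where "code_resolves N L l"
    using ex_string_resolves[OF inj_Phi] string_resolves_iff by blast
  then show ?thesis
    by (intro exI[of _ "prod_encode (N, L)"]) simp
qed

lemma string_resolves_lengths: "string_resolves (out_length l) (in_length l) l"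
  unfolding string_resolves_iff out_length_def in_length_def
  using LeastI_ex[OF ex_resolving[of l], folded resolving_def] by (simp split: if_splits)

lemma recursive_code_h [rec_intros]: "recursive k a \<Longrightarrow> recursive k (\<lambda>xs. code_h (a xs))"
  unfolding code_h_def
  by (intro rec_intros recursive_comp1[OF recursive_computable1[OF H_computable]])

lemma recursive_resolving:
  assumes "recursive k a" shows "recursive k (\<lambda>xs. resolving (a xs))"
proof (rule recursive_comp1[OF _ assms])
  show "recursive 1 (\<lambda>xs. resolving (hd xs))"
    unfolding resolving_def
  proof (rule recursive_Least)
    show "recursive (Suc 1) (\<lambda>xs. if code_resolves (fst (prod_decode (hd xs)))
        (snd (prod_decode (hd xs))) (hd (tl xs)) then 0 else 1)"
      unfolding code_resolves_def by (intro rec_intros) auto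
  qed (rule ex_resolving)
qed

lemma recursive_lengths [rec_intros]:
  assumes "recursive k a"
  shows "recursive k (\<lambda>xs. out_length (a xs))" "recursive k (\<lambda>xs. in_length (a xs))"
  unfolding out_length_def in_length_def by (intro rec_intros recursive_resolving assms)+

section \<open>The averages as a martingale\<close>

definition pulled :: "(bool list \<Rightarrow> real) \<Rightarrow> bool list \<Rightarrow> real" where
  "pulled f \<sigma> = 2 ^ length \<sigma> * pullback f \<sigma> (out_length (length \<sigma>))"

lemma pulled_eq:
  assumes "phi_martingale \<Phi> f" "out_length (length \<sigma>) \<le> N"
  shows "pulled f \<sigma> = 2 ^ length \<sigma> * pullback f \<sigma> N"
  unfolding pulled_def
  using pullback_resolved[OF assms(1) _ assms(2)]
    resolves_if_string_resolves[OF string_resolves_lengths] by simp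

lemma martingale_pulled:
  assumes f: "phi_martingale \<Phi> f" shows "martingale (pulled f)"
  unfolding martingale_def
proof (intro conjI allI)
  fix \<sigma>
  have "0 \<le> f \<tau>" for \<tau>
    using f by (simp add: phi_martingale_def)
  then show "0 \<le> pulled f \<sigma>"
    unfolding pulled_def pullback_def
    by (intro mult_nonneg_nonneg sum_nonneg joint_nonneg) auto
  \<comment> \<open>The least coded pair need not give an increasing \<open>out_length\<close>, so
    parent and children are compared at a depth that is stable for both lengths.\<close>
  let ?N = "max (out_length (length \<sigma>)) (out_length (Suc (length \<sigma>)))"
  have "pulled f \<sigma> = 2 ^ length \<sigma> * pullback f \<sigma> ?N"
    "pulled f (\<sigma> @ [c]) = 2 ^ Suc (length \<sigma>) * pullback f (\<sigma> @ [c]) ?N" for c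
    using pulled_eq[OF f, of \<sigma> ?N] pulled_eq[OF f, of "\<sigma> @ [c]" ?N] by simp_all
  then show "pulled f (\<sigma> @ [False]) + pulled f (\<sigma> @ [True]) = 2 * pulled f \<sigma>"
    by (simp add: pullback_split[of f \<sigma>] algebra_simps)
qed

lemma pulled_ge:
  assumes f: "phi_martingale \<Phi> f"
    and ge: "\<And>\<tau>. n \<le> length \<tau> \<Longrightarrow> take n \<tau> = pre (\<Phi> X) n \<Longrightarrow> K \<le> f \<tau>"
    and l: "n \<le> length (h (pre X l))"
  shows "K \<le> pulled f (pre X l)"
proof -
  \<comment> \<open>At depth n or more the bound on f applies to the image of every input in the
    cylinder; from \<open>out_length l\<close> on the average no longer changes.\<close>
  let ?N = "max n (out_length l)"
  have "K / 2 ^ length (pre X l) \<le> pullback f (pre X l) ?N"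
  proof (rule pullback_ge)
    fix Y
    assume "Y \<in> cyl (pre X l)"
    then have "pre Y l = pre X l"
      by (simp add: cyl_def)
    then have "pre (\<Phi> Y) n = pre (\<Phi> X) n"
      using pre_Phi l by metis
    then show "K \<le> f (pre (\<Phi> Y) ?N)"
      by (intro ge) simp_all
  qed
  moreover have "pulled f (pre X l) = 2 ^ l * pullback f (pre X l) ?N"
    using pulled_eq[OF f, of "pre X l" ?N] by simp
  ultimately show ?thesis
    by (simp add: field_simps)
qed

definition code_total :: "(nat \<Rightarrow> nat \<Rightarrow> nat) \<Rightarrow> nat \<Rightarrow> nat \<Rightarrow> nat \<Rightarrow> nat" where
  "code_total g e l p = (\<Sum>r<2 ^ in_length l. if 2 ^ l + (2 ^ in_length l + r) mod 2 ^ l = e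
    then code_saving g (2 ^ out_length l + code_h (2 ^ in_length l + r) mod 2 ^ out_length l)
      (out_length l) p else 0)"

text \<open>The factor 2 below is the integer encoding of a nonnegative number, and \<open>rat_of_code\<close> adds 1 to
  the encoded denominator.\<close>

definition code_pulled :: "(nat \<Rightarrow> nat \<Rightarrow> nat) \<Rightarrow> nat \<Rightarrow> nat \<Rightarrow> nat" where
  "code_pulled g s p = prod_encode
    (2 * code_total g (Suc s) (code_length (Suc s)) (p + out_length (code_length (Suc s)) + 2),
     2 ^ (in_length (code_length (Suc s)) - code_length (Suc s)
       + (p + out_length (code_length (Suc s)) + 2)) - 1)"

lemma computable_code_pulled:
  assumes "computable2 g" shows "computable2 (code_pulled g)"
proof (rule computable2I)
  have total: "recursive k (\<lambda>xs. code_total g (a xs) (b xs) (c xs))"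
    if "recursive k a" "recursive k b" "recursive k c" for k a b c
  proof (rule recursive_comp3[OF _ that])
    show "recursive 3 (\<lambda>xs. code_total g (hd xs) (hd (tl xs)) (hd (tl (tl xs))))"
      unfolding code_total_def by (intro rec_intros assms) auto
  qed
  show "recursive 2 (\<lambda>xs. code_pulled g (hd xs) (hd (tl xs)))"
    unfolding code_pulled_def by (intro rec_intros total) auto
qed

lemma code_total_enc:
  assumes "length \<sigma> = l"
  shows "code_total g (Suc (enc \<sigma>)) l p = (\<Sum>\<rho> | length \<rho> = in_length l. if take l \<rho> = \<sigma>
    then code_saving g (Suc (enc (take (out_length l) (h \<rho>)))) (out_length l) p else 0)"
proof -
  let ?N = "out_length l" and ?L = "in_length l"
  let ?F = "\<lambda>e. if 2 ^ l + e mod 2 ^ l = Suc (enc \<sigma>)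
    then code_saving g (2 ^ ?N + code_h e mod 2 ^ ?N) ?N p else 0"
  have "(\<Sum>\<rho> | length \<rho> = ?L. if take l \<rho> = \<sigma>
      then code_saving g (Suc (enc (take ?N (h \<rho>)))) ?N p else 0)
      = (\<Sum>\<rho> | length \<rho> = ?L. ?F (Suc (enc \<rho>)))"
  proof (intro sum.cong refl)
    fix \<rho> :: "bool list"
    assume "\<rho> \<in> {\<rho>. length \<rho> = ?L}"
    then have le: "l \<le> length \<rho>" "?N \<le> length (h \<rho>)"
      using string_resolves_lengths[of l] by (simp_all add: string_resolves_def long_enough_def)
    have "take l \<rho> = \<sigma> \<longleftrightarrow> Suc (enc (take l \<rho>)) = Suc (enc \<sigma>)"
      using enc_inj by auto
    then show "(if take l \<rho> = \<sigma> then code_saving g (Suc (enc (take ?N (h \<rho>)))) ?N p else 0)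
        = ?F (Suc (enc \<rho>))"
      by (simp only: code_h_enc Suc_enc_take le)
  qed
  also have "\<dots> = code_total g (Suc (enc \<sigma>)) l p"
    unfolding code_total_def by (rule sum_strings_enc[where f = ?F])
  finally show ?thesis ..
qed

lemma computable_pulled_saving:
  assumes b: "\<And>\<tau>. 0 \<le> b \<tau>" and g: "computable2 g"
    and approx: "\<And>\<tau> p. \<bar>b \<tau> - rat_of_code (g (enc \<tau>) p)\<bar> \<le> 1 / 2 ^ p"
  shows "computable_real_fun (pulled (saving b (\<lambda>\<tau>. scaled (g (enc \<tau>) 0) 0)))"
  unfolding computable_real_fun_def
proof (intro exI[of _ "code_pulled g"] conjI allI computable_code_pulled g)
  fix \<sigma> :: "bool list" and p
  let ?f = "saving b (\<lambda>\<tau>. scaled (g (enc \<tau>) 0) 0)"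
  define l where "l = length \<sigma>"
  define N where "N = out_length l"
  define L where "L = in_length l"
  \<comment> \<open>The accumulated error \<open>3 * (real N + 1)\<close> is at most
    \<open>2 ^ (N + 2)\<close>, so N + 2 extra binary digits bring it down to
    \<open>1 / 2 ^ p\<close>.\<close>
  define q where "q = p + N + 2"
  define s where "s = (\<lambda>\<rho>. real (code_saving g (Suc (enc (take N (h \<rho>)))) N q) / 2 ^ q)"
  \<comment> \<open>The mean of u over the \<open>2 ^ (L - l)\<close> extensions of \<sigma> of
    length L: it is linear and preserves constants, so a uniform error on the strings bounds the
    error of the mean.\<close>
  let ?avg = "\<lambda>u :: bool list \<Rightarrow> real. 2 ^ l * ((\<Sum>\<rho> | length \<rho> = L. if take l \<rho> = \<sigma> then u \<rho> else 0) / 2 ^ L) :: real"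
  have L: "l \<le> L" "long_enough N L"
    using string_resolves_lengths[of l] by (simp_all add: string_resolves_def N_def L_def)
  have avg: "?avg (\<lambda>\<rho>. u (take N (h \<rho>))) = 2 ^ l * pullback u \<sigma> N" for u
    using pullback_eq_average[of \<sigma> L N u] L by (simp add: l_def)
  have avg_const: "?avg (\<lambda>\<rho>. c) = c" for c
    unfolding avg[of "\<lambda>_. c"] pullback_def
    by (simp add: sum_joint l_def flip: sum_distrib_left)
  have avg_diff: "?avg u - ?avg v = ?avg (\<lambda>\<rho>. u \<rho> - v \<rho>)" for u v
    unfolding right_diff_distrib[symmetric] diff_divide_distrib[symmetric] sum_subtractf[symmetric]
    by (intro arg_cong[of _ _ "\<lambda>x. 2 ^ l * (x / 2 ^ L)"] sum.cong) simp_all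
  have avg_abs: "\<bar>?avg u\<bar> \<le> ?avg (\<lambda>\<rho>. c)" if "\<And>\<rho>. length \<rho> = L \<Longrightarrow> \<bar>u \<rho>\<bar> \<le> c" for u c
  proof -
    have "\<bar>\<Sum>\<rho> | length \<rho> = L. if take l \<rho> = \<sigma> then u \<rho> else 0\<bar>
        \<le> (\<Sum>\<rho> | length \<rho> = L. if take l \<rho> = \<sigma> then c else 0)"
      using that by (intro order_trans[OF sum_abs] sum_mono) auto
    then show ?thesis
      by (simp add: abs_mult divide_right_mono)
  qed
  have err: "\<bar>?f (take N (h \<rho>)) - s \<rho>\<bar> \<le> 1 / 2 ^ p" if "length \<rho> = L" for \<rho>
  proof -
    have len: "length (take N (h \<rho>)) = N"
      using L(2) that by (simp add: long_enough_def)
    have "\<bar>?f (take N (h \<rho>)) * 2 ^ q - s \<rho> * 2 ^ q\<bar> \<le> 3 * (real N + 1)"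
      using code_saving_approx[where b = b and g = g and \<tau> = "take N (h \<rho>)" and p = q, OF b approx]
      unfolding len by (simp add: s_def)
    also have "real N + 1 \<le> 2 ^ N"
    proof -
      have "real (Suc N) \<le> real (2 ^ N)"
        unfolding of_nat_le_iff by (rule Suc_leI[OF less_exp])
      then show ?thesis
        by simp
    qed
    also have "3 * (2 :: real) ^ N \<le> 2 ^ (N + 2)"
      by (simp add: power_add)
    finally have "\<bar>?f (take N (h \<rho>)) - s \<rho>\<bar> * 2 ^ q \<le> 1 / 2 ^ p * 2 ^ q"
      by (simp add: q_def power_add abs_mult flip: left_diff_distrib)
    then show ?thesis
      by (rule mult_right_le_imp_le) simp
  qed
  have code: "code_pulled g (enc \<sigma>) p
      = prod_encode (2 * code_total g (Suc (enc \<sigma>)) l q, 2 ^ (L - l + q) - 1)"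
    by (simp only: code_pulled_def code_length_enc l_def N_def L_def q_def)
  have "rat_of_code (code_pulled g (enc \<sigma>) p)
      = real (code_total g (Suc (enc \<sigma>)) l q) / 2 ^ (L - l + q)"
    by (simp add: code rat_of_code_def int_decode_def sum_decode_def)
  also have "\<dots> = ?avg s"
  proof -
    have "real (code_total g (Suc (enc \<sigma>)) l q)
        = (\<Sum>\<rho> | length \<rho> = L. if take l \<rho> = \<sigma> then s \<rho> else 0) * 2 ^ q"
      unfolding code_total_enc[OF l_def[symmetric]] sum_distrib_right of_nat_sum
      by (intro sum.cong) (simp_all add: s_def flip: N_def L_def)
    moreover have "(2 :: real) ^ L = 2 ^ l * 2 ^ (L - l)"
      using L(1) by (simp flip: power_add)
    ultimately show ?thesis
      by (simp add: power_add)
  qed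
  finally have rat: "rat_of_code (code_pulled g (enc \<sigma>) p) = ?avg s" .
  have "pulled ?f \<sigma> = ?avg (\<lambda>\<rho>. ?f (take N (h \<rho>)))"
    unfolding avg by (simp add: pulled_def N_def l_def)
  then have "pulled ?f \<sigma> - rat_of_code (code_pulled g (enc \<sigma>) p)
      = ?avg (\<lambda>\<rho>. ?f (take N (h \<rho>)) - s \<rho>)"
    by (simp only: rat avg_diff)
  also have "\<bar>\<dots>\<bar> \<le> ?avg (\<lambda>\<rho>. 1 / 2 ^ p)"
    using err by (rule avg_abs)
  finally show "\<bar>pulled ?f \<sigma> - rat_of_code (code_pulled g (enc \<sigma>) p)\<bar> \<le> 1 / 2 ^ p"
    unfolding avg_const .
qed

text \<open>A short prefix of \<open>\<Phi> X\<close> already secures a high level. Long prefixes of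
  X force every input in their cylinder to produce it, so the averages tend to infinity, which is
  more than an infinite limsup.\<close>

lemma succeeds_pulled_saving:
  assumes b: "phi_martingale \<Phi> b" and B: "\<And>\<tau>. \<bar>b \<tau> - real (B \<tau>)\<bar> \<le> 2"
    and "succeeds b (\<Phi> X)"
  shows "succeeds (pulled (saving b B)) X"
proof -
  have nonneg: "0 \<le> b \<tau>" for \<tau>
    using b by (simp add: phi_martingale_def)
  have "eventually (\<lambda>l. ereal C < ereal (pulled (saving b B) (pre X l))) sequentially" for C
  proof -
    obtain n where n: "nat \<lceil>2 * C\<rceil> + 1 \<le> level B (pre (\<Phi> X) n) n"
      using level_unbounded[OF B assms(3)] by blast
    then have C: "C < real (level B (pre (\<Phi> X) n) n) / 2"
      by linarith
    obtain l0 where l0: "n \<le> length (h (pre X l0))"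
      using h_unbounded by blast
    have ge: "real (level B (pre (\<Phi> X) n) n) / 2 \<le> pulled (saving b B) (pre X l)" if "l0 \<le> l" for l
    proof (rule pulled_ge)
      show "phi_martingale \<Phi> (saving b B)"
        using b pushmeas_split by (rule phi_martingale_saving)
      show "n \<le> length (h (pre X l))"
        using l0 h_pre_mono[OF that, of X] by linarith
      fix \<tau>
      assume \<tau>: "n \<le> length \<tau>" "take n \<tau> = pre (\<Phi> X) n"
      have "level B (pre (\<Phi> X) n) n = level B \<tau> n"
        unfolding \<tau>(2)[symmetric] by (intro level_cong) simp
      then show "real (level B (pre (\<Phi> X) n) n) / 2 \<le> saving b B \<tau>"
        using saving_ge_level[OF B nonneg \<tau>(1)] by simp
    qed
    show ?thesis
    proof (intro eventually_sequentiallyI[of l0])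
      fix l
      assume "l0 \<le> l"
      then show "ereal C < ereal (pulled (saving b B) (pre X l))"
        using C ge[of l] by simp
    qed
  qed
  then have "(\<lambda>l. ereal (pulled (saving b B) (pre X l))) \<longlonglongrightarrow> \<infinity>"
    by (simp add: tendsto_PInfty)
  then show ?thesis
    unfolding succeeds_def by (intro lim_imp_Limsup) simp_all
qed

end

theorem mainTheorem5:
  fixes \<Phi> :: "(nat \<Rightarrow> bool) \<Rightarrow> (nat \<Rightarrow> bool)" and X :: "nat \<Rightarrow> bool"
  assumes "computable_map \<Phi>" and "inj \<Phi>"
    and "computably_random X"
  shows "computably_random_wrt \<Phi> (\<Phi> X)"
  unfolding computably_random_wrt_def
proof
  assume "\<exists>b. phi_martingale \<Phi> b \<and> computable_real_fun b \<and> succeeds b (\<Phi> X)"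
  then obtain b g where b: "phi_martingale \<Phi> b" "succeeds b (\<Phi> X)" and g: "computable2 g"
    "\<And>\<tau> p. \<bar>b \<tau> - rat_of_code (g (enc \<tau>) p)\<bar> \<le> 1 / 2 ^ p"
    unfolding computable_real_fun_def by blast
  obtain h H where "computable1 H" "\<And>\<sigma>. H (enc \<sigma>) = enc (h \<sigma>)"
    "\<And>\<sigma> \<sigma>'. prefix \<sigma> \<sigma>' \<Longrightarrow> prefix (h \<sigma>) (h \<sigma>')"
    "\<And>X n. h (pre X n) = pre (\<Phi> X) (length (h (pre X n)))"
    "\<And>X k. \<exists>n. k \<le> length (h (pre X n))"
    using assms(1) unfolding computable_map_def by blast
  then interpret computable_injection h \<Phi> H
    using assms(2) by unfold_locales
  \<comment> \<open>Precision 0 suffices, since the withdrawal rule tolerates an error of 2.\<close>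
  let ?B = "\<lambda>\<tau>. scaled (g (enc \<tau>) 0) 0"
  have nonneg: "0 \<le> b \<tau>" for \<tau>
    using b(1) by (simp add: phi_martingale_def)
  have "\<bar>b \<tau> - real (?B \<tau>)\<bar> \<le> 2" for \<tau>
    using scaled_approx[OF nonneg g(2), of \<tau> 0] by simp
  then have "succeeds (pulled (saving b ?B)) X"
    using b by (intro succeeds_pulled_saving)
  moreover have "martingale (pulled (saving b ?B))"
    using b(1) pushmeas_split by (intro martingale_pulled phi_martingale_saving)
  moreover have "computable_real_fun (pulled (saving b ?B))"
    using nonneg g by (rule computable_pulled_saving)
  ultimately show False
    using assms(3) unfolding computably_random_def by blast
qed

end
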